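(* Let $\mathcal N_M$ be the set of computable elements of the Baire space $\mathcal N=\mathbb N^{\mathbb N}$ equipped with the Markov representation. The computable open subsets of $\mathcal N_M$ are not $\Sigma^0_3$-enumerable, i.e. there is no $\Sigma^0_3$ set $S\subseteq\mathbb N$ and computable function $S\to\mathcal O(\mathcal N_M)$ whose image is exactly the set of computable points of $\mathcal O(\mathcal N_M)$.
   Context: A represented space is a pair $\mathbf X=(X,\delta_X)$ with $\delta_X:\subseteq\mathcal N\to X$ a partial surjective map; $p$ is a name of $x$ if $\delta_X(p)=x$; $x$ is computable if it has a computable name. A function $f:\mathbf X\to\mathbf Y$ is continuous (resp. computable) if there is a continuous (resp. computable) realizer $F:\mathrm{dom}(\delta_X)\to\mathrm{dom}(\delta_Y)$ with $\delta_Y(F(p))=f(\delta_X(p))$ for all $p$. $\mathbb N$ is represented by $p\mapsto p(0)$; subsets carry the restricted representation. $\mathcal C(\mathbf X,\mathbf Y)$ is the represented space of continuous functions, a name of $f$ being a standard effective encoding in $\mathcal N$ of any continuous realizer of $f$. The Sierpiński space is $\mathbb S=\{\bot,\top\}$ with $\delta_{\mathbb S}(0^{\mathbb N})=\bot$, $\delta_{\mathbb S}(p)=\top$ for $p\ne0^{\mathbb N}$. $\mathcal O(\mathbf X)=\mathcal C(\mathbf X,\mathbb S)$ is the represented space of open subsets; a computable open subset is a computable point of $\mathcal O(\mathbf X)$. Let $(\varphi_i)_{i\in\mathbb N}$ be a canonical enumeration of the partial computable functions $\mathbb N\to\mathbb N$. The Markov representation of the set of computable (total) functions maps the constant sequence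 with value $i$ to $\varphi_i$, defined when $\varphi_i$ is total. Concretely, a name of an element $\mathcal W$ of $\mathcal O(\mathcal N_M)$ amounts to an enumeration of a set $W\subseteq\mathbb N$ such that for each $i$ with $\varphi_i$ total, $i\in W\iff\varphi_i\in\mathcal W$. So the computable points of $\mathcal O(\mathcal N_M)$ are the sets of total computable functions given by c.e. sets $W$ which are extensional with respect to indices of total computable functions. *)

theory Defs
  imports
    "HOL-Analysis.Function_Topology"
    "HOL-Library.FuncSet"
    "HOL-Library.Nat_Bijection"
begin

section \<open>Partial recursive functions and their canonical enumeration\<close>

text \<open>
  Programs for unary partial recursive functions; functions of several arguments are unary
  functions on Cantor-coded tuples (\<^const>\<open>prod_encode\<close>).
\<close>

datatype prog =
    PZero | PSucc | PFst | PSnd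
  | PPair prog prog | PComp prog prog | PRec prog prog | PMin prog

text \<open>
  In the clause for \<open>PRec\<close>, the argument codes a pair \<open>(a, k)\<close> and the recursion is on \<open>k\<close>.
  In the clause for \<open>PMin\<close>, \<open>k\<close> is the unique witness of the condition, if there is one.
\<close>

primrec eval :: "prog \<Rightarrow> nat \<rightharpoonup> nat" where
  "eval PZero = (\<lambda>n. Some 0)"
| "eval PSucc = (\<lambda>n. Some (Suc n))"
| "eval PFst = (\<lambda>n. Some (fst (prod_decode n)))"
| "eval PSnd = (\<lambda>n. Some (snd (prod_decode n)))"
| "eval (PPair f g) = (\<lambda>n. Option.bind (eval f n) (\<lambda>x.
     Option.bind (eval g n) (\<lambda>y. Some (prod_encode (x, y)))))"
| "eval (PComp f g) = (\<lambda>n. Option.bind (eval g n) (eval f))"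
| "eval (PRec f g) = (\<lambda>n. case prod_decode n of (a, k) \<Rightarrow>
     rec_nat (eval f a)
       (\<lambda>y r. Option.bind r (\<lambda>v. eval g (prod_encode (a, prod_encode (y, v))))) k)"
| "eval (PMin f) = (\<lambda>n.
     if \<exists>k. eval f (prod_encode (n, k)) = Some 0 \<and>
            (\<forall>j<k. \<exists>v. eval f (prod_encode (n, j)) = Some (Suc v))
     then Some (LEAST k. eval f (prod_encode (n, k)) = Some 0)
     else None)"

primrec prog_encode :: "prog \<Rightarrow> nat" where
  "prog_encode PZero = 0"
| "prog_encode PSucc = 1"
| "prog_encode PFst = 2"
| "prog_encode PSnd = 3"
| "prog_encode (PPair f g) = 4 * prod_encode (prog_encode f, prog_encode g) + 4"
| "prog_encode (PComp f g) = 4 * prod_encode (prog_encode f, prog_encode g) + 5"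
| "prog_encode (PRec f g) = 4 * prod_encode (prog_encode f, prog_encode g) + 6"
| "prog_encode (PMin f) = 4 * prog_encode f + 7"

lemma inj_prog_encode: "inj prog_encode"
proof (rule injI)
  have parity: "4 * x + 4 \<noteq> 4 * y + 5" "4 * x + 4 \<noteq> 4 * y + 6" "4 * x + 4 \<noteq> 4 * y + 7"
    "4 * x + 5 \<noteq> 4 * y + 6" "4 * x + 5 \<noteq> 4 * y + 7" "4 * x + 6 \<noteq> 4 * y + 7" for x y :: nat
    by presburger+
  show "f = g" if "prog_encode f = prog_encode g" for f g
    using that
  proof (induction f arbitrary: g)
    case (PPair a b) then show ?case using parity parity[symmetric] by (cases g) simp_all
  next
    case (PComp a b) then show ?case using parity parity[symmetric] by (cases g) simp_all
  next
    case (PRec a b) then show ?case using parity parity[symmetric] by (cases g) simp_all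
  next
    case (PMin a) then show ?case using parity parity[symmetric] by (cases g) simp_all
  qed (case_tac g; simp)+
qed

lemma surj_prog_encode: "surj prog_encode"
proof -
  have "\<exists>f. prog_encode f = n" for n
  proof (induction n rule: less_induct)
    case (less n)
    show ?case
    proof (cases "n < 4")
      case True
      then have "n = 0 \<or> n = 1 \<or> n = 2 \<or> n = 3" by auto
      then show ?thesis
        by (metis prog_encode.simps(1-4))
    next
      case False
      define m where "m = (n - 4) div 4"
      obtain a b where ab: "prod_decode m = (a, b)" by fastforce
      then have m: "m = prod_encode (a, b)" by (metis prod_decode_inverse)
      have "m < n" using False by (auto simp: m_def)
      moreover have "a \<le> m" "b \<le> m"
        using m le_prod_encode_1 le_prod_encode_2 by auto
      ultimately have "a < n" "b < n" "m < n" by auto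
      then obtain f g h where fgh: "prog_encode f = a" "prog_encode g = b" "prog_encode h = m"
        using less by meson
      have "n = 4 * m + 4 \<or> n = 4 * m + 5 \<or> n = 4 * m + 6 \<or> n = 4 * m + 7"
        using False unfolding m_def by presburger
      then show ?thesis
        using fgh m by (metis prog_encode.simps(5-8))
    qed
  qed
  then show ?thesis by (metis surj_def)
qed

lemma bij_prog_encode: "bij prog_encode"
  using inj_prog_encode surj_prog_encode by (rule bijI)

definition phi :: "nat \<Rightarrow> nat \<rightharpoonup> nat" where
  "phi i = eval (inv prog_encode i)"

definition computable :: "(nat \<Rightarrow> nat) \<Rightarrow> bool" where
  "computable f \<longleftrightarrow> (\<exists>i. \<forall>n. phi i n = Some (f n))"

definition decidable :: "nat set \<Rightarrow> bool" where
  "decidable A \<longleftrightarrow> computable (\<lambda>n. if n \<in> A then 1 else 0)"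

definition Sigma03 :: "nat set \<Rightarrow> bool" where
  "Sigma03 S \<longleftrightarrow> (\<exists>R. decidable R \<and>
     S = {n. \<exists>a. \<forall>b. \<exists>c. prod_encode (n, prod_encode (a, prod_encode (b, c))) \<in> R})"


section \<open>Functions on Baire space\<close>

type_synonym baire = "nat \<Rightarrow> nat"

text \<open>
  The standard encoding of partial continuous functions on Baire space by points of Baire
  space (Kleene's associates): \<open>q\<close> encodes \<open>F\<close> on \<open>A\<close> if, for \<open>p \<in> A\<close>, the value
  \<open>F p n\<close> is obtained by feeding longer and longer prefixes of \<open>p\<close> to \<open>q\<close> until the answer
  is nonzero; the first nonzero answer is \<open>F p n + 1\<close>.
  The encodable functions are exactly the continuous ones (\<open>continuous_on_iff_associate\<close>
  below), and the functions with a computable code are the computable ones.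
\<close>

definition query :: "baire \<Rightarrow> nat \<Rightarrow> nat \<Rightarrow> nat" where
  "query p n k = prod_encode (n, list_encode (map p [0..<k]))"

definition associate :: "baire \<Rightarrow> baire set \<Rightarrow> (baire \<Rightarrow> baire) \<Rightarrow> bool" where
  "associate q A F \<longleftrightarrow>
     (\<forall>p\<in>A. \<forall>n. \<exists>k. q (query p n k) = Suc (F p n) \<and> (\<forall>j<k. q (query p n j) = 0))"

definition computable_on :: "baire set \<Rightarrow> (baire \<Rightarrow> baire) \<Rightarrow> bool" where
  "computable_on A F \<longleftrightarrow> (\<exists>q. computable q \<and> associate q A F)"

lemma associate_unique:
  assumes "associate q A F" "associate q A G" "p \<in> A"
  shows "F p = G p"
proof
  fix n
  obtain k where k: "q (query p n k) = Suc (F p n)" "\<forall>j<k. q (query p n j) = 0"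
    using assms unfolding associate_def by blast
  obtain l where l: "q (query p n l) = Suc (G p n)" "\<forall>j<l. q (query p n j) = 0"
    using assms unfolding associate_def by blast
  have "k = l"
    using k l by (metis linorder_neqE_nat nat.distinct(1))
  with k l show "F p n = G p n" by simp
qed

lemma open_prefix: "open {p' :: baire. \<forall>i<k. p' i = p i}"
proof -
  have "{p' :: baire. \<forall>i<k. p' i = p i} = (\<Inter>i\<in>{..<k}. (\<lambda>p'. p' i) -` {p i})"
    by auto
  moreover have "open ((\<lambda>p'. p' i) -` {p i})" for i
    by (rule open_vimage) (auto intro: open_discrete continuous_on_product_coordinates)
  then have "open (\<Inter>i\<in>{..<k}. (\<lambda>p' :: baire. p' i) -` {p i})"
    by (intro open_INT) simp_all
  ultimately show ?thesis by (simp only:)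
qed

lemma open_baire_prefix:
  assumes "open U" "(p :: baire) \<in> U"
  obtains k where "\<And>p'. \<forall>i<k. p' i = p i \<Longrightarrow> p' \<in> U"
proof -
  obtain X where X: "p \<in> Pi\<^sub>E UNIV X" "finite {i. X i \<noteq> UNIV}" "Pi\<^sub>E UNIV X \<subseteq> U"
    using product_topology_open_contains_basis[of "\<lambda>_. euclidean" UNIV U p] assms
    by (auto simp: open_fun_def)
  then obtain k where k: "\<forall>i\<in>{i. X i \<noteq> UNIV}. i < k"
    using finite_nat_set_iff_bounded by blast
  have "p' \<in> U" if "\<forall>i<k. p' i = p i" for p'
  proof -
    have "p' i \<in> X i" for i
      using X(1) k that by (cases "X i = UNIV") (auto simp: PiE_iff)
    then show ?thesis using X(3) by (auto simp: PiE_iff)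
  qed
  then show thesis by (rule that)
qed

lemma continuous_on_iff_associate:
  "continuous_on A F \<longleftrightarrow> (\<exists>q. associate q A F)" for A :: "baire set" and F :: "baire \<Rightarrow> baire"
proof
  assume "\<exists>q. associate q A F"
  then obtain q where q: "associate q A F" by blast
  have "continuous_on A (\<lambda>p. F p n)" for n
    unfolding continuous_on_topological
  proof (intro ballI allI impI)
    fix p B assume p: "p \<in> A" and "F p n \<in> B"
    obtain k where k: "q (query p n k) = Suc (F p n)" "\<forall>j<k. q (query p n j) = 0"
      using q p unfolding associate_def by blast
    let ?U = "{p' :: baire. \<forall>i<k. p' i = p i}"
    have "F p' n = F p n" if p': "p' \<in> A" "p' \<in> ?U" for p'
    proof -
      have "query p' n j = query p n j" if "j \<le> k" for j
        using p' that by (auto simp: query_def intro!: arg_cong[of _ _ list_encode])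
      then have k': "q (query p' n k) = Suc (F p n)" "\<forall>j<k. q (query p' n j) = 0"
        using k by (metis order_refl, metis less_imp_le)
      obtain l where l: "q (query p' n l) = Suc (F p' n)" "\<forall>j<l. q (query p' n j) = 0"
        using q p' unfolding associate_def by blast
      have "k = l"
        using k' l by (metis linorder_neqE_nat nat.distinct(1))
      with k' l show ?thesis by simp
    qed
    then show "\<exists>U. open U \<and> p \<in> U \<and> (\<forall>p'\<in>A. p' \<in> U \<longrightarrow> F p' n \<in> B)"
      using \<open>F p n \<in> B\<close> open_prefix[of k p]
      by (intro exI[of _ ?U] conjI ballI impI) (assumption, blast, metis)
  qed
  then show "continuous_on A F"
    by (rule continuous_on_coordinatewise_then_product)
next
  assume F: "continuous_on A F"
  define good where "good n s m \<longleftrightarrow>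
    (\<exists>p\<in>A. map p [0..<length s] = s) \<and> (\<forall>p\<in>A. map p [0..<length s] = s \<longrightarrow> F p n = m)"
    for n s m
  have good_unique: "m = m'" if "good n s m" "good n s m'" for n s m m'
    using that unfolding good_def by auto
  define q where "q x = (case prod_decode x of (n, s) \<Rightarrow>
    if \<exists>m. good n (list_decode s) m then Suc (THE m. good n (list_decode s) m) else 0)" for x
  have q1: "q (query p n k) = Suc m" if "good n (map p [0..<k]) m" for p n k m
  proof -
    have "(THE m. good n (map p [0..<k]) m) = m"
      by (rule the_equality[where P = "\<lambda>m. good n (map p [0..<k]) m"]) (use that good_unique in blast)+
    then show ?thesis using that by (auto simp: q_def query_def simp del: map_eq_conv)
  qed
  have q0: "q (query p n k) = 0" if "\<nexists>m. good n (map p [0..<k]) m" for p n k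
    using that by (simp add: q_def query_def)
  have "associate q A F"
    unfolding associate_def
  proof (intro ballI allI)
    fix p n assume p: "p \<in> A"
    have val: "m = F p n" if "good n (map p [0..<k]) m" for k m
      using that p unfolding good_def by auto
    have "continuous_on A (\<lambda>p. F p n)"
      using F by (rule continuous_on_product_then_coordinatewise)
    then obtain U where U: "open U" "p \<in> U" "\<forall>p'\<in>A. p' \<in> U \<longrightarrow> F p' n \<in> {F p n}"
      unfolding continuous_on_topological using p by (metis insertI1 open_discrete)
    obtain k where k: "\<And>p'. \<forall>i<k. p' i = p i \<Longrightarrow> p' \<in> U"
      using open_baire_prefix[OF U(1,2)] by blast
    have "F p' n = F p n" if "p' \<in> A" "map p' [0..<k] = map p [0..<k]" for p'
    proof -
      have "p' \<in> U" using that(2) by (intro k) simp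
      then show ?thesis using U(3) that(1) by blast
    qed
    then have "good n (map p [0..<k]) (F p n)"
      unfolding good_def length_map length_upt diff_zero
      by (intro conjI ballI impI bexI[OF refl p])
    then have ex: "\<exists>k m. good n (map p [0..<k]) m" by blast
    define k where "k = (LEAST k. \<exists>m. good n (map p [0..<k]) m)"
    have "\<exists>m. good n (map p [0..<k]) m"
      unfolding k_def using ex by (rule LeastI_ex)
    then have "q (query p n k) = Suc (F p n)"
      using q1 val by blast
    moreover have "q (query p n j) = 0" if "j < k" for j
      using that unfolding k_def by (intro q0) (rule not_less_Least)
    ultimately show "\<exists>k. q (query p n k) = Suc (F p n) \<and> (\<forall>j<k. q (query p n j) = 0)"
      by blast
  qed
  then show "\<exists>q. associate q A F" by blast
qed


section \<open>Represented spaces\<close>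

text \<open>
  A represented space is given by its representation \<open>\<delta>\<close>, a partial map; the underlying
  set is \<^term>\<open>ran \<delta>\<close>, so that \<open>\<delta>\<close> is surjective by construction.
\<close>

type_synonym 'a repr = "baire \<rightharpoonup> 'a"

definition computable_point :: "'a repr \<Rightarrow> 'a \<Rightarrow> bool" where
  "computable_point X x \<longleftrightarrow> (\<exists>p. computable p \<and> X p = Some x)"

definition realizer :: "'a repr \<Rightarrow> 'b repr \<Rightarrow> (baire \<Rightarrow> baire) \<Rightarrow> ('a \<Rightarrow> 'b) \<Rightarrow> bool" where
  "realizer X Y F f \<longleftrightarrow> (\<forall>p x. X p = Some x \<longrightarrow> Y (F p) = Some (f x))"

definition continuous_fun :: "'a repr \<Rightarrow> 'b repr \<Rightarrow> ('a \<Rightarrow> 'b) \<Rightarrow> bool" where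
  "continuous_fun X Y f \<longleftrightarrow> (\<exists>F. continuous_on (dom X) F \<and> realizer X Y F f)"

definition computable_fun :: "'a repr \<Rightarrow> 'b repr \<Rightarrow> ('a \<Rightarrow> 'b) \<Rightarrow> bool" where
  "computable_fun X Y f \<longleftrightarrow> (\<exists>F. computable_on (dom X) F \<and> realizer X Y F f)"

definition restrict_repr :: "'a repr \<Rightarrow> 'a set \<Rightarrow> 'a repr" where
  "restrict_repr X A = X |` {p. \<exists>x\<in>A. X p = Some x}"

text \<open>
  Functions between represented spaces are HOL functions normalised to \<^const>\<open>undefined\<close>
  outside the underlying set of the source (\<^const>\<open>extensional\<close>), so that each function on
  the underlying sets is a single element of the function space.
\<close>

definition fun_space :: "'a repr \<Rightarrow> 'b repr \<Rightarrow> ('a \<Rightarrow> 'b) repr" where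
  "fun_space X Y q =
     (if \<exists>f\<in>extensional (ran X). \<exists>F. associate q (dom X) F \<and> realizer X Y F f
      then Some (THE f. f \<in> extensional (ran X) \<and> (\<exists>F. associate q (dom X) F \<and> realizer X Y F f))
      else None)"

lemma fun_space_eq_Some_iff:
  "fun_space X Y q = Some f \<longleftrightarrow>
     f \<in> extensional (ran X) \<and> (\<exists>F. associate q (dom X) F \<and> realizer X Y F f)"
proof -
  have "f = g"
    if fg: "f \<in> extensional (ran X)" "g \<in> extensional (ran X)"
      and F: "associate q (dom X) F" "realizer X Y F f"
      and G: "associate q (dom X) G" "realizer X Y G g" for f g F G
  proof (rule extensionalityI[OF fg])
    fix x assume "x \<in> ran X"
    then obtain p where p: "X p = Some x" by (auto simp: ran_def)
    then have "F p = G p" using associate_unique[OF F(1) G(1)] by blast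
    then have "Some (f x) = Some (g x)"
      using p F(2) G(2) unfolding realizer_def by metis
    then show "f x = g x" by simp
  qed
  then have uniq: "f = g"
    if "f \<in> extensional (ran X) \<and> (\<exists>F. associate q (dom X) F \<and> realizer X Y F f)"
       "g \<in> extensional (ran X) \<and> (\<exists>F. associate q (dom X) F \<and> realizer X Y F g)" for f g
    using that by blast
  let ?P = "\<lambda>f. f \<in> extensional (ran X) \<and> (\<exists>F. associate q (dom X) F \<and> realizer X Y F f)"
  have the: "(THE f. ?P f) = f" if "?P f" for f
    by (rule the_equality[of ?P, OF that uniq[OF _ that]])
  show ?thesis
  proof (cases "\<exists>f. ?P f")
    case True
    then obtain g where g: "?P g" by blast
    then have "fun_space X Y q = Some g"
      unfolding fun_space_def using the[OF g] by auto
    then show ?thesis using g uniq[of f g] by auto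
  next
    case False
    then show ?thesis unfolding fun_space_def by auto
  qed
qed

lemma ran_fun_space:
  "ran (fun_space X Y) = {f \<in> extensional (ran X). continuous_fun X Y f}"
  by (auto simp: ran_def fun_space_eq_Some_iff continuous_fun_def continuous_on_iff_associate)

definition rep_nat :: "nat repr" where
  "rep_nat p = Some (p 0)"

datatype sierpinski = SBot | STop

definition rep_sierpinski :: "sierpinski repr" where
  "rep_sierpinski p = Some (if p = (\<lambda>_. 0) then SBot else STop)"

text \<open>An open subset is a continuous function to the Sierpinski space.\<close>

definition opens :: "'a repr \<Rightarrow> ('a \<Rightarrow> sierpinski) repr" where
  "opens X = fun_space X rep_sierpinski"

text \<open>The Markov representation: the names are the constant sequences of indices of total functions.\<close>

definition markov :: "baire repr" where
  "markov p =
     (if (\<exists>i. p = (\<lambda>_. i)) \<and> (\<forall>n. phi (p 0) n \<noteq> None)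
      then Some (\<lambda>n. the (phi (p 0) n)) else None)"

lemma markov_eq_Some_iff:
  "markov p = Some f \<longleftrightarrow> (\<exists>i. p = (\<lambda>_. i) \<and> (\<forall>n. phi i n = Some (f n)))"
proof
  assume *: "markov p = Some f"
  then have "\<exists>i. p = (\<lambda>_. i)"
    unfolding markov_def by (rule contrapos_pp) simp
  then obtain i where i: "p = (\<lambda>_. i)" by blast
  have "(\<forall>n. phi i n \<noteq> None) \<and> f = (\<lambda>n. the (phi i n))"
    using * unfolding i by (simp add: markov_def split: if_splits)
  then show "\<exists>i. p = (\<lambda>_. i) \<and> (\<forall>n. phi i n = Some (f n))"
    using i by (intro exI[of _ i]) simp
next
  assume "\<exists>i. p = (\<lambda>_. i) \<and> (\<forall>n. phi i n = Some (f n))"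
  then show "markov p = Some f"
    by (auto simp: markov_def)
qed

lemma ran_markov: "ran markov = {f. computable f}"
  by (auto simp: ran_def markov_eq_Some_iff computable_def)

end

theory Submission
  imports Defs
begin

text \<open>
  The proof is a diagonal argument.  Suppose that \<open>h\<close> maps a \<open>\<Sigma>\<^sup>0\<^sub>3\<close> set \<open>S\<close> onto the computable open
  subsets.  Pairing \<open>n \<in> S\<close> with a witness of its outermost quantifier gives parameters \<open>m\<close> subject to
  a \<open>\<Pi>\<^sup>0\<^sub>2\<close> condition, and for each such \<open>m\<close> a listed set of total functions, semidecidable on
  indices uniformly in \<open>m\<close>.  A semidecidable set of indices has to be found that respects equality of
  total functions (is \<^emph>\<open>extensional\<close>) and differs from every listed set.  Three ideas produce it.

  Certificates.  A total function is read as a pair of sequences, a head and a body.  The head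
  should name a parameter \<open>m\<close> and then list the least witnesses of the \<open>\<Pi>\<^sup>0\<^sub>2\<close> condition.  That a head
  fails to do so is discovered in finite time, and such functions are all put into the set.  If \<open>m\<close>
  violates the condition, no other functions with a head for \<open>m\<close> exist; so when dealing with \<open>m\<close> one may
  rely on the condition, and thus on the extensionality of the \<open>m\<close>-th listed set, although the
  condition need not be semidecidable.

  Evasion.  Over the correct head for \<open>m\<close>, a set of bodies is needed that differs from the listed set.
  It contains the zero body, and differs already if the listed set does not.  But it contains it in
  the manner of Friedberg's example: each index \<open>i\<close> is accepted once it shows more than \<open>i\<close> zeros,
  which adds only those nonzero bodies whose first nonzero position \<open>n\<close> is the one of some index
  below \<open>n\<close>.  Suppose that the zero body is enumerated into the listed set by stage \<open>s\<close>.  Until then,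
  only indices below \<open>s\<close> can have been accepted.  From then on, further indices have to wait until
  they show \<open>N\<close> zeros, where \<open>N\<close> is so large that more than \<open>s\<close> spikes \<open>0\<^sup>k 1 0\<^sup>\<omega>\<close> with \<open>k < N\<close> have been
  enumerated into the listed set.  Each accepted index accounts for one position, so at least
  one of these spikes is listed but stays outside (\<open>diagonal_not_listed\<close>).

  Density.  The bound \<open>N\<close> exists because a semidecidable extensional set that contains the zero body
  contains infinitely many spikes; otherwise the complement of the halting problem would be
  semidecidable (\<open>listed_dense\<close>).

  All this needs that the graph of the universal function is semidecidable (\<open>semidecidable_phi\<close>)
  and a parametrisation of programs (\<open>smn\<close>).
\<close>


section \<open>Computable functions and decidable sets\<close>

abbreviation pair :: "nat \<Rightarrow> nat \<Rightarrow> nat" where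
  "pair a b \<equiv> prod_encode (a, b)"

abbreviation left :: "nat \<Rightarrow> nat" where
  "left n \<equiv> fst (prod_decode n)"

abbreviation right :: "nat \<Rightarrow> nat" where
  "right n \<equiv> snd (prod_decode n)"

lemma computable_iff_eval: "computable f \<longleftrightarrow> (\<exists>e. \<forall>n. eval e n = Some (f n))"
  unfolding computable_def phi_def by (metis inv_f_f inj_prog_encode)

lemma phi_prog_encode [simp]: "phi (prog_encode e) = eval e"
  by (simp add: phi_def inj_prog_encode)

text \<open>
  The rules collected here decompose a function written as one \<open>\<lambda>\<close>-expression in one variable.
  Where the expression binds a further variable (a recursion, a bounded quantifier, a bounded
  count), the premise pairs the old variable and the new one into a single argument, so that
  the same rules apply to it again.  Repeated introduction then proves computability from the
  syntax of the expression alone.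
\<close>
named_theorems computable_intros

lemma computable_id [computable_intros]: "computable (\<lambda>n. n)"
  unfolding computable_iff_eval by (rule exI[of _ "PPair PFst PSnd"]) simp

lemma computable_comp:
  assumes "computable g" "computable f"
  shows "computable (\<lambda>n. g (f n))"
proof -
  obtain a b where "\<forall>n. eval a n = Some (g n)" "\<forall>n. eval b n = Some (f n)"
    using assms unfolding computable_iff_eval by blast
  then show ?thesis
    unfolding computable_iff_eval by (intro exI[of _ "PComp a b"]) simp
qed

lemma computable_Suc [computable_intros]: "computable f \<Longrightarrow> computable (\<lambda>n. Suc (f n))"
  by (rule computable_comp) (auto simp: computable_iff_eval intro: exI[of _ PSucc])

lemma computable_left [computable_intros]: "computable f \<Longrightarrow> computable (\<lambda>n. left (f n))"
  by (rule computable_comp) (auto simp: computable_iff_eval intro: exI[of _ PFst])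

lemma computable_right [computable_intros]: "computable f \<Longrightarrow> computable (\<lambda>n. right (f n))"
  by (rule computable_comp) (auto simp: computable_iff_eval intro: exI[of _ PSnd])

lemma computable_const [computable_intros]: "computable (\<lambda>n. c)"
proof (induction c)
  case 0
  show ?case unfolding computable_iff_eval by (rule exI[of _ PZero]) simp
next
  case (Suc c)
  then show ?case by (rule computable_Suc)
qed

lemma computable_pair [computable_intros]:
  assumes "computable f" "computable g"
  shows "computable (\<lambda>n. pair (f n) (g n))"
proof -
  obtain a b where "\<forall>n. eval a n = Some (f n)" "\<forall>n. eval b n = Some (g n)"
    using assms unfolding computable_iff_eval by blast
  then show ?thesis
    unfolding computable_iff_eval by (intro exI[of _ "PPair a b"]) simp
qed

lemma computable_rec_nat [computable_intros]:
  assumes f: "computable f" and k: "computable k"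
    and g: "computable (\<lambda>m. g (left m) (left (right m)) (right (right m)))"
  shows "computable (\<lambda>n. rec_nat (f n) (g n) (k n))"
proof -
  obtain a where a: "\<forall>n. eval a n = Some (f n)"
    using f unfolding computable_iff_eval by blast
  obtain b where b: "\<forall>m. eval b m = Some (g (left m) (left (right m)) (right (right m)))"
    using g unfolding computable_iff_eval by blast
  have "rec_nat (eval a n)
      (\<lambda>y r. Option.bind r (\<lambda>v. eval b (pair n (pair y v)))) j = Some (rec_nat (f n) (g n) j)"
    for n j
    by (induction j) (simp_all add: a b)
  then have "computable (\<lambda>m. rec_nat (f (left m)) (g (left m)) (right m))"
    unfolding computable_iff_eval
    by (intro exI[of _ "PRec a b"]) (simp split: prod.split)
  from computable_comp[OF this computable_pair[OF computable_id k]] show ?thesis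
    by simp
qed

lemma computable_add [computable_intros]:
  assumes "computable f" "computable g"
  shows "computable (\<lambda>n. f n + g n)"
proof -
  have "rec_nat a (\<lambda>_ r. Suc r) b = a + b" for a b :: nat
    by (induction b) auto
  moreover have "computable (\<lambda>n. rec_nat (f n) (\<lambda>_ r. Suc r) (g n))"
    by (intro computable_intros assms)
  ultimately show ?thesis by simp
qed

lemma computable_mult [computable_intros]:
  assumes "computable f" "computable g"
  shows "computable (\<lambda>n. f n * g n)"
proof -
  have "rec_nat 0 (\<lambda>_ r. r + a) b = a * b" for a b :: nat
    by (induction b) auto
  moreover have "computable (\<lambda>n. rec_nat 0 (\<lambda>_ r. r + f n) (g n))"
    by (intro computable_intros assms computable_comp[OF assms(1)])
  ultimately show ?thesis by simp
qed

lemma computable_power [computable_intros]: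
  assumes "computable f" "computable g"
  shows "computable (\<lambda>n. f n ^ g n)"
proof -
  have "rec_nat 1 (\<lambda>_ r. r * a) b = a ^ b" for a b :: nat
    by (induction b) auto
  moreover have "computable (\<lambda>n. rec_nat 1 (\<lambda>_ r. r * f n) (g n))"
    by (intro computable_intros assms computable_comp[OF assms(1)])
  ultimately show ?thesis by simp
qed

lemma computable_diff [computable_intros]:
  assumes "computable f" "computable g"
  shows "computable (\<lambda>n. f n - g n)"
proof -
  have pred: "rec_nat 0 (\<lambda>y _. y) a = a - 1" for a :: nat
    by (cases a) auto
  have "computable (\<lambda>n. rec_nat 0 (\<lambda>y _. y) n)"
    by (intro computable_intros)
  then have pred': "computable (\<lambda>n. n - 1)" by (simp only: pred)
  have "rec_nat a (\<lambda>_ r. r - 1) b = a - b" for a b :: nat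
    by (induction b) auto
  moreover have "computable (\<lambda>n. rec_nat (f n) (\<lambda>_ r. r - 1) (g n))"
    by (intro computable_intros assms computable_comp[OF pred'])
  ultimately show ?thesis by simp
qed

lemma decidable_iff: "decidable {n. P n} \<longleftrightarrow> computable (\<lambda>n. if P n then 1 else 0)"
  by (simp add: decidable_def)

lemma computable_if [computable_intros]:
  assumes "decidable {n. P n}" "computable f" "computable g"
  shows "computable (\<lambda>n. if P n then f n else g n)"
proof -
  have "computable (\<lambda>n. (if P n then 1 else 0) * f n + (1 - (if P n then 1 else 0)) * g n)"
    by (intro computable_intros assms assms(1)[unfolded decidable_iff])
  moreover have "(if P n then 1 else 0) * f n + (1 - (if P n then 1 else 0)) * g n
      = (if P n then f n else g n)" for n
    by simp
  ultimately show ?thesis by (simp only:)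
qed

lemma decidable_comp:
  assumes "decidable {n. P n}" "computable f"
  shows "decidable {n. P (f n)}"
  using computable_comp[OF assms(1)[unfolded decidable_iff] assms(2)]
  by (simp add: decidable_iff)

lemma decidable_le [computable_intros]:
  assumes "computable f" "computable g"
  shows "decidable {n. f n \<le> g n}"
proof -
  have "computable (\<lambda>n. 1 - (f n - g n))"
    by (intro computable_intros assms)
  moreover have "1 - (f n - g n) = (if f n \<le> g n then 1 else 0)" for n by simp
  ultimately show ?thesis by (simp only: decidable_iff)
qed

lemma decidable_not [computable_intros]:
  assumes "decidable {n. P n}"
  shows "decidable {n. \<not> P n}"
proof -
  have "computable (\<lambda>n. if P n then 0 else 1)"
    by (intro computable_intros assms)
  moreover have "(if P n then 0 else 1) = (if \<not> P n then 1 else (0::nat))" for n by simp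
  ultimately show ?thesis by (simp only: decidable_iff)
qed

lemma decidable_conj [computable_intros]:
  assumes "decidable {n. P n}" "decidable {n. Q n}"
  shows "decidable {n. P n \<and> Q n}"
proof -
  have "computable (\<lambda>n. if P n then if Q n then 1 else 0 else 0)"
    by (intro computable_intros assms)
  moreover have "(if P n then if Q n then 1 else 0 else 0) = (if P n \<and> Q n then 1 else (0::nat))" for n
    by simp
  ultimately show ?thesis by (simp only: decidable_iff)
qed

lemma decidable_disj [computable_intros]:
  assumes "decidable {n. P n}" "decidable {n. Q n}"
  shows "decidable {n. P n \<or> Q n}"
  using decidable_not[OF decidable_conj[OF assms[THEN decidable_not]]] by simp

lemma decidable_less [computable_intros]:
  assumes "computable f" "computable g"
  shows "decidable {n. f n < g n}"
  using decidable_le[OF computable_Suc[OF assms(1)] assms(2)] by (simp add: Suc_le_eq)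

lemma decidable_eq [computable_intros]:
  assumes "computable f" "computable g"
  shows "decidable {n. f n = g n}"
  using decidable_conj[OF decidable_le[OF assms] decidable_le[OF assms(2,1)]]
  by (simp add: eq_iff)

text \<open>
  Counting the witnesses below a bound yields the bounded quantifiers: existence means a nonzero
  count.
\<close>
lemma computable_card_less [computable_intros]:
  assumes P: "decidable {m. P (left m) (right m)}" and b: "computable b"
  shows "computable (\<lambda>n. card {k. k < b n \<and> P n k})"
proof -
  have "rec_nat 0 (\<lambda>y r. r + (if Q y then 1 else 0)) b = card {k. k < b \<and> Q k}"
    for b and Q :: "nat \<Rightarrow> bool"
  proof (induction b)
    case (Suc b)
    have "{k. k < Suc b \<and> Q k} = (if Q b then insert b {k. k < b \<and> Q k} else {k. k < b \<and> Q k})"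
      by (auto simp: less_Suc_eq)
    then show ?case using Suc by simp
  qed simp
  moreover have "computable (\<lambda>n. rec_nat 0 (\<lambda>y r. r + (if P n y then 1 else 0)) (b n))"
  proof (intro computable_intros b)
    have "decidable {m. P (left (pair (left m) (left (right m)))) (right (pair (left m) (left (right m))))}"
      by (rule decidable_comp[OF P]) (intro computable_intros)
    then show "decidable {m. P (left m) (left (right m))}" by simp
  qed
  ultimately show ?thesis by simp
qed

lemma decidable_ex_less [computable_intros]:
  assumes "decidable {m. P (left m) (right m)}" "computable b"
  shows "decidable {n. \<exists>k<b n. P n k}"
proof -
  have "decidable {n. 0 < card {k. k < b n \<and> P n k}}"
    by (intro computable_intros assms)
  moreover have "0 < card {k. k < b n \<and> P n k} \<longleftrightarrow> (\<exists>k<b n. P n k)" for n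
    by (subst card_gt_0_iff) auto
  ultimately show ?thesis by simp
qed

lemma decidable_all_less [computable_intros]:
  assumes "decidable {m. P (left m) (right m)}" "computable b"
  shows "decidable {n. \<forall>k<b n. P n k}"
proof -
  have "decidable {n. \<not> (\<exists>k<b n. \<not> P n k)}"
    by (intro computable_intros assms)
  then show ?thesis by simp
qed

lemma decidable_ex_le [computable_intros]:
  assumes "decidable {m. P (left m) (right m)}" "computable b"
  shows "decidable {n. \<exists>k\<le>b n. P n k}"
  using decidable_ex_less[OF assms(1) computable_Suc[OF assms(2)]]
  by (simp add: less_Suc_eq_le)

text \<open>
  The number \<open>z\<close> codes the finite set of positions of the ones in its binary expansion; digit
  \<open>x\<close> is the parity of the quotient in the division of \<open>z\<close> by \<open>2 ^ x\<close>.
\<close>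
lemma decidable_set_decode [computable_intros]:
  assumes "computable f" "computable g"
  shows "decidable {n. f n \<in> set_decode (g n)}"
proof -
  have "x \<in> set_decode z \<longleftrightarrow> (\<exists>q<Suc z. \<exists>r<2 ^ x. z = (2 * q + 1) * 2 ^ x + r)" for x z
  proof
    assume "x \<in> set_decode z"
    then obtain q where "z div 2 ^ x = 2 * q + 1"
      by (auto simp: set_decode_def elim: oddE)
    then have z: "z = (2 * q + 1) * 2 ^ x + z mod 2 ^ x"
      by (metis div_mult_mod_eq)
    have "2 * q + 1 \<le> z" using \<open>z div 2 ^ x = 2 * q + 1\<close> by (metis div_le_dividend)
    with z show "\<exists>q<Suc z. \<exists>r<2 ^ x. z = (2 * q + 1) * 2 ^ x + r"
      by (intro exI[of _ q] conjI exI[of _ "z mod 2 ^ x"]) auto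
  next
    assume "\<exists>q<Suc z. \<exists>r<2 ^ x. z = (2 * q + 1) * 2 ^ x + r"
    then obtain q r where "r < 2 ^ x" "z = (2 * q + 1) * 2 ^ x + r" by blast
    then have "z div 2 ^ x = 2 * q + 1"
      by (metis add.right_neutral div_less div_mult_self3 nat_zero_less_power_iff not_less_zero)
    then show "x \<in> set_decode z" by (simp add: set_decode_def)
  qed
  moreover have "decidable {n. \<exists>q<Suc (g n). \<exists>r<2 ^ f n. g n = (2 * q + 1) * 2 ^ f n + r}"
    by (intro computable_intros assms computable_comp[OF assms(1)] computable_comp[OF assms(2)])
  ultimately show ?thesis by simp
qed


section \<open>Semidecidable sets\<close>

definition semidecidable :: "nat set \<Rightarrow> bool" where
  "semidecidable A \<longleftrightarrow> (\<exists>R. decidable {n. R n} \<and> A = {n. \<exists>w. R (pair n w)})"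

lemma semidecidable_ex_decidable:
  assumes "decidable {m. R (left m) (right m)}"
  shows "semidecidable {n. \<exists>w. R n w}"
  unfolding semidecidable_def
  by (rule exI[of _ "\<lambda>m. R (left m) (right m)"]) (simp add: assms)

lemma semidecidableE:
  assumes "semidecidable {n. P n}"
  obtains R where "decidable {m. R (left m) (right m)}" "\<And>n. P n \<longleftrightarrow> (\<exists>w. R n w)"
proof -
  obtain R where R: "decidable {n. R n}" "{n. P n} = {n. \<exists>w. R (pair n w)}"
    using assms unfolding semidecidable_def by blast
  show thesis
    by (rule that[of "\<lambda>n w. R (pair n w)"]) (use R in auto)
qed

text \<open>
  These rules follow the pattern of the computability rules.  The inclusion of the decidable sets
  is kept out of them, because it would apply to every goal and cut the decomposition short.
\<close>
named_theorems semidecidable_intros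

lemma semidecidable_decidable:
  assumes "decidable {n. P n}"
  shows "semidecidable {n. P n}"
proof -
  have "semidecidable {n. \<exists>w::nat. P n}"
    by (rule semidecidable_ex_decidable) (rule decidable_comp[OF assms], intro computable_intros)
  then show ?thesis by simp
qed

lemma semidecidable_comp:
  assumes "semidecidable {n. P n}" "computable f"
  shows "semidecidable {n. P (f n)}"
proof -
  obtain R where R: "decidable {m. R (left m) (right m)}" "\<And>n. P n \<longleftrightarrow> (\<exists>w. R n w)"
    using assms(1) by (rule semidecidableE) blast
  have "decidable {m. R (left (pair (f (left m)) (right m))) (right (pair (f (left m)) (right m)))}"
    by (rule decidable_comp[OF R(1)]) (intro computable_intros computable_comp[OF assms(2)])
  then have "semidecidable {n. \<exists>w. R (f n) w}"
    by (intro semidecidable_ex_decidable) simp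
  then show ?thesis by (simp add: R(2))
qed

lemma semidecidable_comp2:
  assumes "semidecidable {m. P (left m) (right m)}" "computable f" "computable g"
  shows "semidecidable {n. P (f n) (g n)}"
  using semidecidable_comp[OF assms(1) computable_pair[OF assms(2,3)]] by simp

lemma computable_comp2:
  assumes "computable (\<lambda>m. g (left m) (right m))" "computable f" "computable h"
  shows "computable (\<lambda>n. g (f n) (h n))"
  using computable_comp[OF assms(1) computable_pair[OF assms(2,3)]] by simp

lemma decidable_comp2:
  assumes "decidable {m. P (left m) (right m)}" "computable f" "computable g"
  shows "decidable {n. P (f n) (g n)}"
  using decidable_comp[OF assms(1) computable_pair[OF assms(2,3)]] by simp

lemma decidable_comp3:
  assumes "decidable {m. P (left m) (left (right m)) (right (right m))}"
    "computable f" "computable g" "computable h"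
  shows "decidable {n. P (f n) (g n) (h n)}"
  using decidable_comp[OF assms(1) computable_pair[OF assms(2) computable_pair[OF assms(3,4)]]]
  by simp

lemma semidecidable_ex [semidecidable_intros]:
  assumes "semidecidable {m. P (left m) (right m)}"
  shows "semidecidable {n. \<exists>k. P n k}"
proof -
  obtain R where R: "decidable {m. R (left m) (right m)}"
    "\<And>m. P (left m) (right m) \<longleftrightarrow> (\<exists>w. R m w)"
    using assms by (rule semidecidableE) blast
  have "semidecidable {n. \<exists>w. R (pair n (left w)) (right w)}"
    by (intro semidecidable_ex_decidable decidable_comp2[OF R(1)] computable_intros)
  moreover have "(\<exists>w. R (pair n (left w)) (right w)) \<longleftrightarrow> (\<exists>k. P n k)" for n
  proof -
    have "(\<exists>k. P n k) \<longleftrightarrow> (\<exists>k w. R (pair n k) w)"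
      using R(2)[of "pair n _"] by simp
    also have "\<dots> \<longleftrightarrow> (\<exists>w. R (pair n (left w)) (right w))"
      by (metis fst_conv snd_conv prod_encode_inverse)
    finally show ?thesis by blast
  qed
  ultimately show ?thesis by simp
qed

lemma semidecidable_conj [semidecidable_intros]:
  assumes "semidecidable {n. P n}" "semidecidable {n. Q n}"
  shows "semidecidable {n. P n \<and> Q n}"
proof -
  obtain R where R: "decidable {m. R (left m) (right m)}" "\<And>n. P n \<longleftrightarrow> (\<exists>w. R n w)"
    using assms(1) by (rule semidecidableE) blast
  obtain T where T: "decidable {m. T (left m) (right m)}" "\<And>n. Q n \<longleftrightarrow> (\<exists>w. T n w)"
    using assms(2) by (rule semidecidableE) blast
  have "semidecidable {n. \<exists>v w. R n v \<and> T n w}"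
    by (intro semidecidable_ex semidecidable_decidable decidable_conj
        decidable_comp2[OF R(1)] decidable_comp2[OF T(1)] computable_intros)
  then show ?thesis by (simp add: R(2) T(2))
qed

lemma semidecidable_disj [semidecidable_intros]:
  assumes "semidecidable {n. P n}" "semidecidable {n. Q n}"
  shows "semidecidable {n. P n \<or> Q n}"
proof -
  obtain R where R: "decidable {m. R (left m) (right m)}" "\<And>n. P n \<longleftrightarrow> (\<exists>w. R n w)"
    using assms(1) by (rule semidecidableE) blast
  obtain T where T: "decidable {m. T (left m) (right m)}" "\<And>n. Q n \<longleftrightarrow> (\<exists>w. T n w)"
    using assms(2) by (rule semidecidableE) blast
  have "semidecidable {n. \<exists>w. R n w \<or> T n w}"
    by (intro semidecidable_ex semidecidable_decidable decidable_disj
        decidable_comp2[OF R(1)] decidable_comp2[OF T(1)] computable_intros)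
  then show ?thesis by (simp add: R(2) T(2) ex_disj_distrib)
qed

lemma semidecidable_imp [semidecidable_intros]:
  assumes "decidable {n. P n}" "semidecidable {n. Q n}"
  shows "semidecidable {n. P n \<longrightarrow> Q n}"
  using semidecidable_disj[OF semidecidable_decidable[OF decidable_not[OF assms(1)]] assms(2)]
  by (simp only: imp_conv_disj)

text \<open>
  Finitely many witnesses have a common bound, so that one unbounded search for this bound
  replaces a search for each \<open>k\<close>.
\<close>
lemma semidecidable_all_less [semidecidable_intros]:
  assumes "semidecidable {m. P (left m) (right m)}" and b: "computable b"
  shows "semidecidable {n. \<forall>k<b n. P n k}"
proof -
  obtain R where R: "decidable {m. R (left m) (right m)}"
    "\<And>m. P (left m) (right m) \<longleftrightarrow> (\<exists>w. R m w)"
    using assms(1) by (rule semidecidableE) blast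
  have R': "P n k \<longleftrightarrow> (\<exists>w. R (pair n k) w)" for n k
    using R(2)[of "pair n k"] by simp
  have "semidecidable {n. \<exists>v. \<forall>k<b n. \<exists>w<v. R (pair n k) w}"
    by (intro semidecidable_ex semidecidable_decidable
        decidable_comp2[OF R(1)] computable_intros computable_comp[OF b])
  moreover have "(\<exists>v. \<forall>k<c. \<exists>w<v. R (pair n k) w) \<longleftrightarrow> (\<forall>k<c. P n k)" for n c
  proof
    assume "\<forall>k<c. P n k"
    then show "\<exists>v. \<forall>k<c. \<exists>w<v. R (pair n k) w"
    proof (induction c)
      case (Suc c)
      then obtain v where v: "\<forall>k<c. \<exists>w<v. R (pair n k) w" by auto
      obtain w where w: "R (pair n c) w" using Suc.prems R' by blast
      show ?case
        by (rule exI[of _ "max v (Suc w)"])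
          (use v w in \<open>auto simp: less_Suc_eq less_max_iff_disj\<close>)
    qed simp
  qed (use R' in blast)
  ultimately show ?thesis by simp
qed


section \<open>The graph of the universal function\<close>

abbreviation triple :: "nat \<Rightarrow> nat \<Rightarrow> nat \<Rightarrow> nat" where
  "triple e x y \<equiv> pair e (pair x y)"

text \<open>
  The triple \<open>(e, x, y)\<close> claims that program \<open>e\<close> maps \<open>x\<close> to \<open>y\<close>.  A claim is justified by a set
  of claims if one clause of the evaluation function derives it from members of the set; the
  numbers \<open>4 * d + 4\<close> to \<open>4 * d + 7\<close> are the codes of compound programs.
\<close>
definition justified :: "nat set \<Rightarrow> nat \<Rightarrow> nat \<Rightarrow> nat \<Rightarrow> bool" where
  "justified Z e x y \<longleftrightarrow>
     e = 0 \<and> y = 0 \<or> e = 1 \<and> y = Suc x \<or> e = 2 \<and> y = left x \<or> e = 3 \<and> y = right x \<or>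
     (\<exists>d. e = 4 * d + 4 \<and> triple (left d) x (left y) \<in> Z \<and> triple (right d) x (right y) \<in> Z) \<or>
     (\<exists>d. e = 4 * d + 5 \<and> (\<exists>v. triple (right d) x v \<in> Z \<and> triple (left d) v y \<in> Z)) \<or>
     (\<exists>d. e = 4 * d + 6 \<and>
        (right x = 0 \<and> triple (left d) (left x) y \<in> Z \<or>
         (\<exists>k. right x = Suc k \<and> (\<exists>v. triple e (pair (left x) k) v \<in> Z \<and>
            triple (right d) (pair (left x) (pair k v)) y \<in> Z)))) \<or>
     (\<exists>d. e = 4 * d + 7 \<and> triple d (pair x y) 0 \<in> Z \<and>
        (\<forall>j<y. \<exists>v. triple d (pair x j) (Suc v) \<in> Z))"

text \<open>
  No order is imposed on the claims of the set.  Each clause refers to smaller programs or to an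
  earlier step of the same recursion, so that justifications cannot run in a circle.  Hence a
  computation is witnessed by a mere finite set, and no sequence of steps has to be coded.
\<close>
definition self_justifying :: "nat set \<Rightarrow> bool" where
  "self_justifying Z \<longleftrightarrow> (\<forall>t\<in>Z. justified Z (left t) (left (right t)) (right (right t)))"

lemma justified_mono:
  assumes "justified Z e x y" "Z \<subseteq> Z'"
  shows "justified Z' e x y"
  using assms(1) unfolding justified_def
  by (elim disj_forward ex_forward conj_forward all_forward imp_forward) (use assms(2) in auto)

lemma self_justifyingD:
  "self_justifying Z \<Longrightarrow> triple e x y \<in> Z \<Longrightarrow> justified Z e x y"
  unfolding self_justifying_def by fastforce

lemma codes_distinct:
  "4 * x + 4 \<noteq> 4 * y + (5::nat)" "4 * x + 4 \<noteq> 4 * y + (6::nat)" "4 * x + 4 \<noteq> 4 * y + (7::nat)"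
  "4 * x + 5 \<noteq> 4 * y + (6::nat)" "4 * x + 5 \<noteq> 4 * y + (7::nat)" "4 * x + 6 \<noteq> 4 * y + (7::nat)"
  "4 * x + 4 \<noteq> (3::nat)" "4 * x + 5 \<noteq> (3::nat)" "4 * x + 6 \<noteq> (3::nat)" "4 * x + 7 \<noteq> (3::nat)"
  for x y :: nat
  by presburger+

lemma justified_PPair:
  "justified Z (4 * pair f g + 4) x y \<longleftrightarrow> triple f x (left y) \<in> Z \<and> triple g x (right y) \<in> Z"
  unfolding justified_def using codes_distinct codes_distinct[symmetric] by auto

lemma justified_PComp:
  "justified Z (4 * pair f g + 5) x y \<longleftrightarrow> (\<exists>v. triple g x v \<in> Z \<and> triple f v y \<in> Z)"
  unfolding justified_def using codes_distinct codes_distinct[symmetric] by auto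

lemma justified_PRec_0:
  "justified Z (4 * pair f g + 6) (pair a 0) y \<longleftrightarrow> triple f a y \<in> Z"
  unfolding justified_def using codes_distinct codes_distinct[symmetric] by auto

lemma justified_PRec_Suc:
  "justified Z (4 * pair f g + 6) (pair a (Suc k)) y \<longleftrightarrow>
     (\<exists>v. triple (4 * pair f g + 6) (pair a k) v \<in> Z \<and> triple g (pair a (pair k v)) y \<in> Z)"
  unfolding justified_def using codes_distinct codes_distinct[symmetric] by auto

lemma justified_PMin:
  "justified Z (4 * f + 7) x y \<longleftrightarrow>
     triple f (pair x y) 0 \<in> Z \<and> (\<forall>j<y. \<exists>v. triple f (pair x j) (Suc v) \<in> Z)"
  unfolding justified_def using codes_distinct codes_distinct[symmetric] by auto

lemma self_justifying_sound:
  assumes Z: "self_justifying Z" and "triple (prog_encode f) x y \<in> Z"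
  shows "eval f x = Some y"
  using assms(2)
proof (induction f arbitrary: x y)
  case (PPair f g)
  from self_justifyingD[OF Z PPair.prems]
  have "triple (prog_encode f) x (left y) \<in> Z" "triple (prog_encode g) x (right y) \<in> Z"
    by (simp_all only: prog_encode.simps justified_PPair)
  then show ?case using PPair.IH by simp
next
  case (PComp f g)
  from self_justifyingD[OF Z PComp.prems]
  obtain v where "triple (prog_encode g) x v \<in> Z" "triple (prog_encode f) v y \<in> Z"
    by (auto simp only: prog_encode.simps justified_PComp)
  then show ?case using PComp.IH by simp
next
  case (PRec f g)
  have "eval (PRec f g) (pair a k) = Some y" if "triple (prog_encode (PRec f g)) (pair a k) y \<in> Z" for a k y
    using that
  proof (induction k arbitrary: y)
    case 0
    from self_justifyingD[OF Z this]
    have "triple (prog_encode f) a y \<in> Z" by (simp only: prog_encode.simps justified_PRec_0)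
    then show ?case using PRec.IH by simp
  next
    case (Suc k)
    from self_justifyingD[OF Z Suc.prems]
    obtain v where "triple (prog_encode (PRec f g)) (pair a k) v \<in> Z"
      "triple (prog_encode g) (pair a (pair k v)) y \<in> Z"
      by (auto simp only: prog_encode.simps justified_PRec_Suc)
    then show ?case using Suc.IH PRec.IH(2) by simp
  qed
  from this[of "left x" "right x" y] show ?case using PRec.prems by simp
next
  case (PMin f)
  from self_justifyingD[OF Z PMin.prems]
  have y: "triple (prog_encode f) (pair x y) 0 \<in> Z" "\<forall>j<y. \<exists>v. triple (prog_encode f) (pair x j) (Suc v) \<in> Z"
    by (auto simp only: prog_encode.simps justified_PMin)
  then have *: "eval f (pair x y) = Some 0" "\<forall>j<y. \<exists>v. eval f (pair x j) = Some (Suc v)"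
    using PMin.IH by blast+
  moreover have "(LEAST k. eval f (pair x k) = Some 0) = y"
    by (rule Least_equality) (use * in \<open>auto simp: not_less[symmetric]\<close>)
  ultimately show ?case by auto
qed (drule self_justifyingD[OF Z], simp add: justified_def codes_distinct[symmetric])+

definition derivable :: "nat \<Rightarrow> bool" where
  "derivable t \<longleftrightarrow> (\<exists>Z. finite Z \<and> self_justifying Z \<and> t \<in> Z)"

text \<open>
  Self-justifying sets are closed under union because justification is monotone; adding a claim
  that the union justifies keeps it self-justifying.
\<close>
lemma derivableI:
  assumes "finite T" "\<And>t. t \<in> T \<Longrightarrow> derivable t" "justified T e x y"
  shows "derivable (triple e x y)"
proof -
  have "\<forall>t\<in>T. \<exists>Z. finite Z \<and> self_justifying Z \<and> t \<in> Z"
    using assms(2) unfolding derivable_def by blast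
  from bchoice[OF this] obtain Z where Z: "\<forall>t\<in>T. finite (Z t) \<and> self_justifying (Z t) \<and> t \<in> Z t" ..
  let ?Z = "insert (triple e x y) (\<Union>t\<in>T. Z t)"
  have "justified ?Z (left s) (left (right s)) (right (right s))" if "t \<in> T" "s \<in> Z t" for s t
  proof (rule justified_mono)
    show "justified (Z t) (left s) (left (right s)) (right (right s))"
      using bspec[OF Z that(1)] that(2) unfolding self_justifying_def by blast
    show "Z t \<subseteq> ?Z" using that(1) by blast
  qed
  moreover have "justified ?Z e x y"
    using assms(3) by (rule justified_mono) (use Z in blast)
  ultimately have "self_justifying ?Z"
    unfolding self_justifying_def by simp
  then show ?thesis
    unfolding derivable_def using Z assms(1) by (intro exI[of _ ?Z]) auto
qed

lemma eval_derivable: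
  assumes "eval f x = Some y"
  shows "derivable (triple (prog_encode f) x y)"
  using assms
proof (induction f arbitrary: x y)
  case (PPair f g)
  then obtain a b where ab: "eval f x = Some a" "eval g x = Some b" "y = pair a b"
    by (auto simp: bind_eq_Some_conv)
  show ?case
    by (rule derivableI[of "{triple (prog_encode f) x a, triple (prog_encode g) x b}"])
      (use ab PPair.IH in \<open>auto simp: justified_PPair\<close>)
next
  case (PComp f g)
  then obtain v where v: "eval g x = Some v" "eval f v = Some y"
    by (auto simp: bind_eq_Some_conv)
  show ?case
    by (rule derivableI[of "{triple (prog_encode g) x v, triple (prog_encode f) v y}"])
      (use v PComp.IH in \<open>auto simp: justified_PComp\<close>)
next
  case (PRec f g)
  have "derivable (triple (prog_encode (PRec f g)) (pair a k) y)"
    if "eval (PRec f g) (pair a k) = Some y" for a k y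
    using that
  proof (induction k arbitrary: y)
    case 0
    then have "derivable (triple (prog_encode f) a y)" using PRec.IH(1) by simp
    then show ?case
      by (intro derivableI[of "{triple (prog_encode f) a y}"])
        (auto simp: justified_PRec_0)
  next
    case (Suc k)
    then obtain v where v: "eval (PRec f g) (pair a k) = Some v"
      "eval g (pair a (pair k v)) = Some y"
      by (auto simp: bind_eq_Some_conv)
    have "derivable (triple (prog_encode (PRec f g)) (pair a k) v)"
      "derivable (triple (prog_encode g) (pair a (pair k v)) y)"
      using v Suc.IH PRec.IH(2) by blast+
    then show ?case
      by (intro derivableI[of "{triple (prog_encode (PRec f g)) (pair a k) v,
            triple (prog_encode g) (pair a (pair k v)) y}"])
        (auto simp: justified_PRec_Suc)
  qed
  from this[of "left x" "right x" y] PRec.prems show ?case by simp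
next
  case (PMin f)
  from PMin.prems have ex: "\<exists>k. eval f (pair x k) = Some 0 \<and> (\<forall>j<k. \<exists>v. eval f (pair x j) = Some (Suc v))"
    by (auto split: if_splits)
  then obtain k where k: "eval f (pair x k) = Some 0" "\<forall>j<k. \<exists>v. eval f (pair x j) = Some (Suc v)"
    by blast
  have "(LEAST k. eval f (pair x k) = Some 0) = k"
    by (rule Least_equality) (use k in \<open>auto simp: not_less[symmetric]\<close>)
  with PMin.prems ex have y: "y = k" by auto
  obtain v where v: "\<And>j. j < k \<Longrightarrow> eval f (pair x j) = Some (Suc (v j))"
    using k(2) by metis
  show ?case
    by (rule derivableI[of "insert (triple (prog_encode f) (pair x k) 0)
          ((\<lambda>j. triple (prog_encode f) (pair x j) (Suc (v j))) ` {..<k})"])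
      (use k v y PMin.IH in \<open>auto simp: justified_PMin\<close>)
qed (rule derivableI[of "{}"]; simp add: justified_def)+

lemma phi_eq_Some_iff:
  "phi e x = Some y \<longleftrightarrow> (\<exists>z. self_justifying (set_decode z) \<and> triple e x y \<in> set_decode z)"
proof -
  obtain f where f: "e = prog_encode f"
    using surj_prog_encode by (metis surjD)
  show ?thesis
  proof
    assume "phi e x = Some y"
    then obtain Z where "finite Z" "self_justifying Z" "triple e x y \<in> Z"
      using eval_derivable[of f x y] unfolding f derivable_def by auto
    then show "\<exists>z. self_justifying (set_decode z) \<and> triple e x y \<in> set_decode z"
      by (intro exI[of _ "set_encode Z"]) simp
  next
    assume "\<exists>z. self_justifying (set_decode z) \<and> triple e x y \<in> set_decode z"
    then show "phi e x = Some y"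
      using self_justifying_sound[of _ f x y] unfolding f by auto
  qed
qed

lemma set_decode_less: "t \<in> set_decode z \<Longrightarrow> t < z"
proof -
  assume "t \<in> set_decode z"
  then have "2 ^ t \<le> z"
    by (auto simp: set_decode_def intro: ccontr)
  then show "t < z" by (meson less_exp order_less_le_trans)
qed

text \<open>
  This is the universal machine: the number \<open>z\<close> searched for codes a self-justifying set, and being
  self-justifying only concerns the elements of that set, all of which are below \<open>z\<close>.
\<close>
lemma semidecidable_phi [semidecidable_intros]:
  assumes "computable e" "computable x" "computable y"
  shows "semidecidable {n. phi (e n) (x n) = Some (y n)}"
proof -
  have "self_justifying (set_decode z) \<longleftrightarrow> (\<forall>t<z. t \<in> set_decode z \<longrightarrow>
      justified (set_decode z) (left t) (left (right t)) (right (right t)))" for z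
    unfolding self_justifying_def using set_decode_less by blast
  then have phi: "phi e x = Some y \<longleftrightarrow> (\<exists>z. (\<forall>t<z. t \<in> set_decode z \<longrightarrow>
      justified (set_decode z) (left t) (left (right t)) (right (right t))) \<and>
      triple e x y \<in> set_decode z)" for e x y
    by (simp add: phi_eq_Some_iff)
  have "semidecidable {n. phi (left n) (left (right n)) = Some (right (right n))}"
    unfolding phi justified_def
    by (intro semidecidable_intros computable_intros; (rule semidecidable_decidable, intro computable_intros)?)
  from semidecidable_comp[OF this, of "\<lambda>n. triple (e n) (x n) (y n)"] show ?thesis
    using assms by (simp add: computable_intros)
qed


section \<open>Search, parametrisation and the halting problem\<close>

lemma unbounded_search:
  assumes "decidable {m. R (left m) (right m)}"
  obtains e where "\<And>x. eval e x = (if \<exists>k. R x k then Some (LEAST k. R x k) else None)"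
proof -
  have "computable (\<lambda>m. if R (left m) (right m) then 0 else 1)"
    by (intro computable_intros assms)
  then obtain a where a: "\<And>m. eval a m = Some (if R (left m) (right m) then 0 else 1)"
    unfolding computable_iff_eval by blast
  have "eval (PMin a) x = (if \<exists>k. R x k then Some (LEAST k. R x k) else None)" for x
  proof (cases "\<exists>k. R x k")
    case True
    then have "R x (LEAST k. R x k)" by (rule LeastI_ex)
    then have "\<exists>k. eval a (pair x k) = Some 0 \<and> (\<forall>j<k. \<exists>v. eval a (pair x j) = Some (Suc v))"
      by (intro exI[of _ "LEAST k. R x k"]) (auto simp: a dest: not_less_Least)
    moreover have "eval a (pair x k) = Some 0 \<longleftrightarrow> R x k" for k by (simp add: a)
    ultimately show ?thesis using True by simp
  qed (auto simp: a)
  then show thesis by (rule that)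
qed

lemma semidecidable_domain:
  assumes "semidecidable {n. P n}"
  obtains i where "\<And>n. P n \<longleftrightarrow> phi i n \<noteq> None"
proof -
  obtain R where R: "decidable {m. R (left m) (right m)}" "\<And>n. P n \<longleftrightarrow> (\<exists>w. R n w)"
    using assms by (rule semidecidableE) blast
  obtain e where "\<And>x. eval e x = (if \<exists>k. R x k then Some (LEAST k. R x k) else None)"
    using R(1) by (rule unbounded_search) blast
  then show thesis
    by (intro that[of "prog_encode e"]) (simp add: R(2))
qed

lemma semidecidable_halting: "semidecidable {e. phi e e \<noteq> None}"
proof -
  have "semidecidable {e. \<exists>y. phi e e = Some y}"
    by (intro semidecidable_intros computable_intros)
  then show ?thesis by simp
qed

lemma not_semidecidable_nonhalting: "\<not> semidecidable {e. phi e e = None}"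
proof
  assume "semidecidable {e. phi e e = None}"
  then obtain i where "\<And>e. phi e e = None \<longleftrightarrow> phi i e \<noteq> None"
    by (rule semidecidable_domain) blast
  from this[of i] show False by blast
qed

text \<open>
  Fixing the left component of the argument is precomposition with a constant program, whose code
  \<open>num m\<close> is computed from the constant by recursion: \<open>m\<close> successors applied to zero.
\<close>
lemma smn:
  obtains J where "computable J" "\<And>m x. phi (J m) x = eval e (pair m x)"
proof -
  define num where "num m = rec_nat (0::nat) (\<lambda>_ r. 4 * pair 1 r + 5) m" for m
  define J where "J m = 4 * pair (prog_encode e)
      (4 * pair (num m) (prog_encode (PPair PFst PSnd)) + 4) + 5" for m
  have num: "\<exists>c. prog_encode c = num m \<and> (\<forall>x. eval c x = Some m)" for m
  proof (induction m)
    case 0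
    show ?case by (rule exI[of _ PZero]) (simp add: num_def)
  next
    case (Suc m)
    then obtain c where "prog_encode c = num m" "\<forall>x. eval c x = Some m" by blast
    then show ?case by (intro exI[of _ "PComp PSucc c"]) (simp add: num_def)
  qed
  have "phi (J m) x = eval e (pair m x)" for m x
  proof -
    obtain c where c: "prog_encode c = num m" "\<forall>x. eval c x = Some m"
      using num by blast
    then have "J m = prog_encode (PComp e (PPair c (PPair PFst PSnd)))"
      by (simp add: J_def)
    then have "phi (J m) x = eval (PComp e (PPair c (PPair PFst PSnd))) x"
      by (simp only: phi_prog_encode)
    then show ?thesis using c by simp
  qed
  moreover have "computable J"
    unfolding J_def num_def by (intro computable_intros)
  ultimately show thesis using that by blast
qed


section \<open>Functions carrying a certificate\<close>

text \<open>
  Let \<open>R\<close> be a matrix of a \<open>\<Pi>\<^sup>0\<^sub>2\<close> property \<open>\<forall>b. \<exists>c. R m b c\<close> of \<open>m\<close>.  The sequence \<open>head R m\<close> names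
  \<open>m\<close> and then lists the least witnesses.  It is the one certificate of the property: a sequence that
  starts with \<open>m\<close> and is no certificate shows this at a finite stage.
\<close>
definition head :: "(nat \<Rightarrow> nat \<Rightarrow> nat \<Rightarrow> bool) \<Rightarrow> nat \<Rightarrow> nat \<Rightarrow> nat" where
  "head R m x = (case x of 0 \<Rightarrow> m | Suc b \<Rightarrow> LEAST c. R m b c)"

text \<open>
  The search for the certificate is a partial computation, total only if \<open>m\<close> has the property; the
  index of the resulting program is nevertheless computable from every \<open>m\<close>.
\<close>
lemma index_head_body:
  assumes R: "decidable {n. R (left n) (left (right n)) (right (right n))}"
    and body: "computable (\<lambda>n. body (left n) (right n))"
  obtains J where "computable (\<lambda>n. J (left n) (right n))"
    "\<And>m e x. \<forall>b. \<exists>c. R m b c \<Longrightarrow> phi (J m e) x = Some (pair (head R m x) (body e x))"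
proof -
  define Q where "Q n c \<longleftrightarrow> right n = 0 \<and> c = left (left n) \<or>
    (\<exists>b<right n. right n = Suc b \<and> R (left (left n)) b c)" for n c
  have "decidable {n. Q (left n) (right n)}"
    unfolding Q_def by (intro computable_intros decidable_comp3[OF R])
  then obtain s where s: "\<And>n. eval s n = (if \<exists>c. Q n c then Some (LEAST c. Q n c) else None)"
    by (rule unbounded_search) blast
  have "computable (\<lambda>n. body (right (left n)) (right n))"
    by (intro computable_comp2[OF body] computable_intros)
  then obtain t where t: "\<And>n. eval t n = Some (body (right (left n)) (right n))"
    unfolding computable_iff_eval by blast
  obtain J where J: "computable J" "\<And>n x. phi (J n) x = eval (PPair s t) (pair n x)"
    by (rule smn) blast
  have "eval s (pair (pair m e) x) = Some (head R m x)" if "\<forall>b. \<exists>c. R m b c" for m e x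
  proof (cases x)
    case 0
    then have "Q (pair (pair m e) x) = (\<lambda>c. c = m)" by (auto simp: Q_def fun_eq_iff)
    moreover have "(LEAST c. c = m) = m" by (rule Least_equality) auto
    ultimately show ?thesis using 0 by (simp add: s head_def)
  next
    case (Suc b)
    then have "Q (pair (pair m e) x) = R m b" by (auto simp: Q_def fun_eq_iff)
    then show ?thesis using Suc that by (simp add: s head_def)
  qed
  then have "phi (J (pair m e)) x = Some (pair (head R m x) (body e x))"
    if "\<forall>b. \<exists>c. R m b c" for m e x
    using that by (simp add: J(2) t)
  moreover have "computable (\<lambda>n. J (pair (left n) (right n)))"
    using J(1) by simp
  ultimately show thesis
    by (intro that[of "\<lambda>m e. J (pair m e)"]) auto
qed


section \<open>Diagonalising against a family of extensional sets\<close>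

text \<open>
  The relation \<open>enum m i w\<close> says that the search through all \<open>w\<close> enumerates the index \<open>i\<close> into the
  \<open>m\<close>-th set of a family.  Extensionality is available only for those \<open>m\<close> that have the
  \<open>\<Pi>\<^sup>0\<^sub>2\<close> property given by \<open>R\<close>.  A total function is read as the pair of a head (its left components)
  and a body (its right components).  The number \<open>index m e\<close> is an index of the function whose head
  is the certificate of \<open>m\<close> and whose body is the zero sequence \<open>0\<^sup>\<omega>\<close> for \<open>e = 0\<close> and the spike
  \<open>0\<^sup>k 1 0\<^sup>\<omega>\<close> for \<open>e = Suc k\<close>.
\<close>
locale extensional_family =
  fixes R :: "nat \<Rightarrow> nat \<Rightarrow> nat \<Rightarrow> bool"
    and enum :: "nat \<Rightarrow> nat \<Rightarrow> nat \<Rightarrow> bool"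
    and index :: "nat \<Rightarrow> nat \<Rightarrow> nat"
  assumes decidable_R: "decidable {n. R (left n) (left (right n)) (right (right n))}"
    and decidable_enum: "decidable {n. enum (left n) (left (right n)) (right (right n))}"
    and computable_index: "computable (\<lambda>n. index (left n) (right n))"
    and phi_index: "\<And>m e x. \<forall>b. \<exists>c. R m b c \<Longrightarrow>
      phi (index m e) x = Some (pair (head R m x) (if e = Suc x then 1 else 0))"
    and extensional: "\<And>m i j. \<forall>b. \<exists>c. R m b c \<Longrightarrow> \<forall>x. phi i x \<noteq> None \<Longrightarrow> phi i = phi j \<Longrightarrow>
      (\<exists>w. enum m i w) \<longleftrightarrow> (\<exists>w. enum m j w)"
begin

definition listed :: "nat \<Rightarrow> nat \<Rightarrow> bool" where
  "listed m i \<longleftrightarrow> (\<exists>w. enum m i w)"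

text \<open>
  A listed set that contains the zero body contains spikes arbitrarily far out.  Otherwise a
  program could run a given computation and produce the zero body as long as it does not halt, and
  a far spike as soon as it does.  This function would be listed exactly if the computation does
  not halt, which would make the complement of the halting problem semidecidable.
\<close>
lemma listed_dense:
  assumes m: "\<forall>b. \<exists>c. R m b c" and zero: "listed m (index m 0)"
  shows "\<exists>k\<ge>k0. listed m (index m (Suc k))"
proof (rule ccontr)
  assume contra: "\<not> (\<exists>k\<ge>k0. listed m (index m (Suc k)))"
  obtain H where H: "decidable {n. H (left n) (right n)}"
    "\<And>e. phi e e \<noteq> None \<longleftrightarrow> (\<exists>w. H e w)"
    using semidecidable_halting by (rule semidecidableE) blast
  \<comment> \<open>\<open>Q e x\<close> is monotone in \<open>x\<close>, and its first \<open>x\<close> is at least \<open>k0\<close>: there the body has its spike.\<close>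
  define Q where "Q e x \<longleftrightarrow> \<not> x < k0 \<and> (\<exists>w\<le>x. H e w)" for e x
  define body where "body e x = (if Q e x \<and> (\<forall>y<x. \<not> Q e y) then 1 else 0 :: nat)" for e x
  have "computable (\<lambda>n. body (left n) (right n))"
    unfolding body_def Q_def by (intro computable_intros decidable_comp2[OF H(1)])
  with decidable_R obtain I where I: "computable (\<lambda>n. I (left n) (right n))"
    "\<And>m e x. \<forall>b. \<exists>c. R m b c \<Longrightarrow> phi (I m e) x = Some (pair (head R m x) (body e x))"
    by (rule index_head_body) blast
  have total: "\<forall>x. phi (I m e) x \<noteq> None" for e by (simp add: I(2)[OF m])
  have "phi e e = None \<longleftrightarrow> (\<exists>w. enum m (I m e) w)" for e
  proof (cases "phi e e = None")
    case True
    then have "\<not> H e w" for w using H(2) by blast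
    then have "body e x = 0" for x by (simp add: body_def Q_def)
    then have "phi (I m e) = phi (index m 0)" using m by (simp add: fun_eq_iff I(2) phi_index)
    then have "(\<exists>w. enum m (I m e) w) \<longleftrightarrow> listed m (index m 0)"
      unfolding listed_def by (rule extensional[OF m total])
    then show ?thesis using zero True by blast
  next
    case False
    then obtain w where "H e w" using H(2) by blast
    then have "Q e (max k0 w)" unfolding Q_def by (intro conjI exI[of _ w]) auto
    then have k: "Q e (LEAST x. Q e x)" by (rule LeastI)
    let ?k = "LEAST x. Q e x"
    have "Q e x \<and> (\<forall>y<x. \<not> Q e y) \<longleftrightarrow> x = ?k" for x
      using k by (metis linorder_neqE_nat not_less_Least)
    then have "body e x = (if Suc ?k = Suc x then 1 else 0)" for x
      unfolding body_def by auto
    then have "phi (I m e) = phi (index m (Suc ?k))" using m by (simp add: fun_eq_iff I(2) phi_index)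
    then have "(\<exists>w. enum m (I m e) w) \<longleftrightarrow> listed m (index m (Suc ?k))"
      unfolding listed_def by (rule extensional[OF m total])
    moreover have "k0 \<le> ?k" using k by (simp add: Q_def)
    ultimately show ?thesis using contra False by blast
  qed
  moreover have "semidecidable {e. \<exists>w. enum m (I m e) w}"
    by (intro semidecidable_ex semidecidable_decidable decidable_comp3[OF decidable_enum]
        computable_comp2[OF I(1)] computable_intros)
  ultimately show False using not_semidecidable_nonhalting by simp
qed

definition zero_seen :: "nat \<Rightarrow> nat \<Rightarrow> bool" where
  "zero_seen m u \<longleftrightarrow> (\<exists>w\<le>u. enum m (index m 0) w)"

definition zero_below :: "nat \<Rightarrow> nat \<Rightarrow> bool" where
  "zero_below i n \<longleftrightarrow> (\<forall>x<n. \<exists>v. phi i x = Some v \<and> right v = 0)"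

definition first_nonzero :: "nat \<Rightarrow> nat \<Rightarrow> bool" where
  "first_nonzero i n \<longleftrightarrow> zero_below i n \<and> (\<exists>v. phi i n = Some v \<and> \<not> right v = 0)"

definition refuted :: "nat \<Rightarrow> nat \<Rightarrow> bool" where
  "refuted m i \<longleftrightarrow> (\<exists>b v. phi i (Suc b) = Some v \<and>
     \<not> (R m b (left v) \<and> (\<forall>c<left v. \<not> R m b c)))"

text \<open>
  By stage \<open>s\<close> the zero body has been enumerated, so that only indices below \<open>s\<close> can have been
  committed to before.  More than \<open>s\<close> listed spikes below \<open>N\<close> are more than these indices can account for.
\<close>
definition plenty :: "nat \<Rightarrow> nat \<Rightarrow> bool" where
  "plenty m N \<longleftrightarrow> (\<exists>s. zero_seen m s \<and> s < card {k. k < N \<and> (\<exists>w\<le>N. enum m (index m (Suc k)) w)})"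

text \<open>
  A set of bodies that is to differ from the \<open>m\<close>-th listed set over the certificate of \<open>m\<close>.  Until the
  zero body has been enumerated there, the first disjunct accepts every index that shows more zeros
  than its own size, so that the zero body gets in if it is never enumerated.  This commits the set
  only to sparse nonzero bodies, gathered in the second disjunct: those whose first nonzero position
  is also that of some index smaller than this position.  Once the zero body has been enumerated, the
  commitment to it remains, but is discharged by the third disjunct, which accepts bodies that
  vanish up to a bound \<open>N\<close> so large that some listed spike below \<open>N\<close> stays out.
\<close>
definition evading :: "nat \<Rightarrow> nat \<Rightarrow> bool" where
  "evading m i \<longleftrightarrow>
     (\<exists>u. i < u \<and> \<not> zero_seen m u \<and> zero_below i u) \<or>
     (\<exists>n j. j < n \<and> \<not> zero_seen m j \<and> first_nonzero i n \<and> first_nonzero j n) \<or>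
     (\<exists>N. plenty m N \<and> zero_below i N)"

text \<open>
  A function with a wrong certificate is accepted outright.  So \<open>evading m\<close> matters only for those \<open>m\<close>
  that have the \<open>\<Pi>\<^sup>0\<^sub>2\<close> property, although this property need not be semidecidable.
\<close>
definition diagonal :: "nat \<Rightarrow> bool" where
  "diagonal i \<longleftrightarrow> (\<exists>v. phi i 0 = Some v \<and> (refuted (left v) i \<or> evading (left v) i))"

lemma zero_seen_mono: "zero_seen m u \<Longrightarrow> u \<le> u' \<Longrightarrow> zero_seen m u'"
  unfolding zero_seen_def by (meson le_trans)

lemma first_nonzero_unique: "first_nonzero i n \<Longrightarrow> first_nonzero i n' \<Longrightarrow> n = n'"
  unfolding first_nonzero_def zero_below_def
  by (metis linorder_neqE_nat option.inject)

lemma semidecidable_diagonal: "semidecidable {i. diagonal i}"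
proof -
  have zero_seen: "decidable {n. zero_seen (left n) (right n)}"
    unfolding zero_seen_def
    by (intro computable_intros decidable_comp3[OF decidable_enum] computable_comp2[OF computable_index])
  have zero: "semidecidable {n. zero_below (left n) (right n)}"
    unfolding zero_below_def
    by (intro semidecidable_intros computable_intros;
        (rule semidecidable_decidable, intro computable_intros)?)
  have first: "semidecidable {n. first_nonzero (left n) (right n)}"
    unfolding first_nonzero_def
    by (intro semidecidable_intros computable_intros semidecidable_comp2[OF zero];
        (rule semidecidable_decidable, intro computable_intros)?)
  have plenty: "semidecidable {n. plenty (left n) (right n)}"
    unfolding plenty_def
    by (intro semidecidable_ex semidecidable_decidable computable_intros decidable_comp2[OF zero_seen]
        decidable_comp3[OF decidable_enum] computable_comp2[OF computable_index])
  show ?thesis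
    unfolding diagonal_def evading_def refuted_def
    by (intro semidecidable_intros computable_intros semidecidable_comp2[OF zero]
        semidecidable_comp2[OF first] semidecidable_comp2[OF plenty];
        (rule semidecidable_decidable, intro computable_intros decidable_comp2[OF zero_seen]
          decidable_comp3[OF decidable_R])?)
qed

lemma plenty_ex:
  assumes m: "\<forall>b. \<exists>c. R m b c" and zero: "listed m (index m 0)"
  shows "\<exists>N. plenty m N"
proof -
  obtain s where s: "zero_seen m s"
    using zero unfolding listed_def zero_seen_def by blast
  have "infinite {k. listed m (index m (Suc k))}"
    unfolding infinite_nat_iff_unbounded_le using listed_dense[OF m zero] by blast
  then obtain T where T: "T \<subseteq> {k. listed m (index m (Suc k))}" "card T = Suc s" "finite T"
    using infinite_arbitrarily_large by blast
  then have "\<forall>k\<in>T. \<exists>w. enum m (index m (Suc k)) w" unfolding listed_def by blast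
  from bchoice[OF this] obtain w where w: "\<forall>k\<in>T. enum m (index m (Suc k)) (w k)" ..
  define N where "N = Suc (Max (T \<union> w ` T))"
  have bound: "k < N \<and> w k \<le> N" if "k \<in> T" for k
    using that T(3) unfolding N_def by (auto simp: less_Suc_eq_le intro!: Max_ge le_SucI)
  have "T \<subseteq> {k. k < N \<and> (\<exists>w\<le>N. enum m (index m (Suc k)) w)}"
    using bound w by blast
  from card_mono[OF _ this] have "Suc s \<le> card {k. k < N \<and> (\<exists>w\<le>N. enum m (index m (Suc k)) w)}"
    using T(2) by simp
  then show ?thesis using s unfolding plenty_def by (auto simp: Suc_le_eq)
qed

text \<open>
  The right-hand side depends on the body only and not on its index.  An index \<open>i\<close> of a nonzero body
  that enters by the first disjunct has its first nonzero position \<open>n\<close> beyond \<open>i\<close>, so that \<open>i\<close> itself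
  is the small index which the second disjunct asks for.  If the zero body is listed, it is accepted
  for every index because a bound \<open>N\<close> exists.
\<close>
lemma evading_iff:
  assumes m: "\<forall>b. \<exists>c. R m b c" and total: "\<forall>x. phi i x \<noteq> None"
  shows "evading m i \<longleftrightarrow> (\<forall>n. zero_below i n) \<or>
    (\<exists>n. first_nonzero i n \<and>
      ((\<exists>j<n. \<not> zero_seen m j \<and> first_nonzero j n) \<or> (\<exists>N\<le>n. plenty m N)))"
    (is "_ \<longleftrightarrow> ?zero \<or> ?nonzero")
proof (cases ?zero)
  case True
  have "evading m i"
  proof (cases "listed m (index m 0)")
    case True
    then show ?thesis using plenty_ex[OF m] \<open>?zero\<close> unfolding evading_def by blast
  next
    case False
    then have "\<not> zero_seen m (Suc i)" unfolding listed_def zero_seen_def by blast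
    then show ?thesis using \<open>?zero\<close> unfolding evading_def by blast
  qed
  with True show ?thesis by blast
next
  case False
  then obtain n where n: "\<not> zero_below i n" "\<And>n'. n' < n \<Longrightarrow> zero_below i n'"
    using exists_least_iff[of "\<lambda>n. \<not> zero_below i n"] by blast
  then obtain n' where n': "n = Suc n'"
    by (cases n) (auto simp: zero_below_def)
  obtain v where v: "phi i n' = Some v" using total by (metis not_None_eq)
  have "zero_below i n'" using n(2) n' by simp
  moreover have "right v \<noteq> 0"
    using n(1) v calculation unfolding zero_below_def n' by (auto simp: less_Suc_eq)
  ultimately have first: "first_nonzero i n'"
    using v unfolding first_nonzero_def by blast
  have le: "u \<le> n'" if "zero_below i u" for u
  proof (rule ccontr)
    assume "\<not> u \<le> n'"
    then have "n' < u" by simp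
    then show False using that v \<open>right v \<noteq> 0\<close> unfolding zero_below_def by fastforce
  qed
  have "zero_below i u" if "u \<le> n'" for u
    using \<open>zero_below i n'\<close> that unfolding zero_below_def by auto
  with le have below: "zero_below i u \<longleftrightarrow> u \<le> n'" for u by blast
  have "?nonzero \<longleftrightarrow> (\<exists>j<n'. \<not> zero_seen m j \<and> first_nonzero j n') \<or> (\<exists>N\<le>n'. plenty m N)"
    using first first_nonzero_unique by blast
  moreover have "evading m i \<longleftrightarrow> (\<exists>j<n'. \<not> zero_seen m j \<and> first_nonzero j n') \<or> (\<exists>N\<le>n'. plenty m N)"
    (is "_ \<longleftrightarrow> ?rhs")
  proof
    assume "evading m i"
    then consider u where "i < u" "\<not> zero_seen m u" "u \<le> n'"
      | j where "j < n'" "\<not> zero_seen m j" "first_nonzero j n'" | N where "plenty m N" "N \<le> n'"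
      unfolding evading_def below using first first_nonzero_unique by blast
    then show ?rhs
    proof cases
      case 1
      then have "i < n'" "\<not> zero_seen m i" using zero_seen_mono by auto
      then show ?thesis using first by blast
    qed blast+
  next
    assume ?rhs
    then show "evading m i" unfolding evading_def below using first by blast
  qed
  ultimately show ?thesis using False by blast
qed

lemma diagonal_extensional:
  assumes total: "\<forall>x. phi i x \<noteq> None" and eq: "phi i = phi j"
  shows "diagonal i \<longleftrightarrow> diagonal j"
proof -
  obtain v where v: "phi i 0 = Some v" using total by (metis not_None_eq)
  have ref: "refuted (left v) i \<longleftrightarrow> refuted (left v) j" unfolding refuted_def eq ..
  show ?thesis
  proof (cases "refuted (left v) i")
    case True
    then show ?thesis using ref v eq unfolding diagonal_def by auto
  next
    case False
    have m: "\<forall>b. \<exists>c. R (left v) b c"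
    proof
      fix b
      obtain u where "phi i (Suc b) = Some u" using total by (metis not_None_eq)
      then show "\<exists>c. R (left v) b c" using False unfolding refuted_def by blast
    qed
    have zero: "zero_below i = zero_below j"
      unfolding zero_below_def eq ..
    then have first: "first_nonzero i = first_nonzero j"
      unfolding first_nonzero_def eq by simp
    have "evading (left v) i \<longleftrightarrow> evading (left v) j"
      using evading_iff[OF m total] evading_iff[OF m total[unfolded eq]] zero first by simp
    then show ?thesis using ref v eq unfolding diagonal_def by auto
  qed
qed

lemma diagonal_index:
  assumes m: "\<forall>b. \<exists>c. R m b c"
  shows "diagonal (index m e) \<longleftrightarrow> evading m (index m e)"
proof -
  have "\<not> refuted m (index m e)"
    unfolding refuted_def using m LeastI_ex[of "R m _"] not_less_Least
    by (fastforce simp: phi_index[OF m] head_def)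
  then show ?thesis unfolding diagonal_def by (simp add: phi_index[OF m] head_def)
qed

text \<open>
  If the two sets agreed on all bodies \<open>index m e\<close>, the zero body would be listed, since it is
  accepted.  Take the least \<open>N\<close> with plenty of listed spikes, more than \<open>s\<close> of them.  These spikes are
  accepted, and, being too early for the third disjunct, each one has its position marked by
  an index below \<open>s\<close>.  An index marks only one position, so there are at most \<open>s\<close> of them.
\<close>
lemma diagonal_not_listed:
  assumes m: "\<forall>b. \<exists>c. R m b c"
  shows "\<exists>e. diagonal (index m e) \<noteq> listed m (index m e)"
proof (rule ccontr)
  assume "\<not> ?thesis"
  then have agree: "listed m (index m e) \<longleftrightarrow> evading m (index m e)" for e using diagonal_index[OF m] by blast
  have total: "\<forall>x. phi (index m e) x \<noteq> None" for e by (simp add: phi_index[OF m])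
  have "zero_below (index m 0) n" for n
    unfolding zero_below_def by (simp add: phi_index[OF m])
  then have zero: "listed m (index m 0)" using agree evading_iff[OF m total] by blast
  have first: "first_nonzero (index m (Suc k)) n \<longleftrightarrow> n = k" for k n
  proof -
    have "first_nonzero (index m (Suc k)) k"
      unfolding first_nonzero_def zero_below_def by (simp add: phi_index[OF m])
    then show ?thesis using first_nonzero_unique by blast
  qed
  define N where "N = (LEAST N. plenty m N)"
  have "plenty m N" unfolding N_def using plenty_ex[OF m zero] by (rule LeastI_ex)
  have least: "N \<le> n" if "plenty m n" for n unfolding N_def using that by (rule Least_le)
  define T where "T = {k. k < N \<and> (\<exists>w\<le>N. enum m (index m (Suc k)) w)}"
  obtain s where s: "zero_seen m s" "s < card T"
    using \<open>plenty m N\<close> unfolding plenty_def T_def by blast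
  have "finite T" unfolding T_def by simp
  have "T \<subseteq> (\<lambda>j. THE n. first_nonzero j n) ` {..<s}"
  proof
    fix k assume k: "k \<in> T"
    then have "listed m (index m (Suc k))" unfolding T_def listed_def by blast
    moreover have "\<not> zero_below (index m (Suc k)) (Suc k)"
      unfolding zero_below_def by (auto simp: phi_index[OF m])
    ultimately have "(\<exists>j<k. \<not> zero_seen m j \<and> first_nonzero j k) \<or> (\<exists>N\<le>k. plenty m N)"
      using agree evading_iff[OF m total] first by auto
    moreover have "\<not> (\<exists>N\<le>k. plenty m N)"
      using k least unfolding T_def by fastforce
    ultimately obtain j where j: "\<not> zero_seen m j" "first_nonzero j k" by blast
    then have "j < s" using s(1) zero_seen_mono by (meson not_less)
    moreover have "(THE n. first_nonzero j n) = k"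
      using j(2) first_nonzero_unique by blast
    ultimately show "k \<in> (\<lambda>j. THE n. first_nonzero j n) ` {..<s}" by blast
  qed
  then have "card T \<le> s"
    using surj_card_le[of "{..<s}" T] by simp
  with s(2) show False by simp
qed

end


section \<open>Open subsets in the Markov representation\<close>

lemma computable_query_const [computable_intros]:
  assumes "computable f" "computable g" "computable k"
  shows "computable (\<lambda>n. query (\<lambda>_. f n) (g n) (k n))"
proof -
  have "rec_nat 0 (\<lambda>_ r. Suc (pair a r)) b = list_encode (map (\<lambda>_. a) [0..<b])" for a b
    unfolding map_replicate_const by (induction b) simp_all
  moreover have "computable (\<lambda>n. pair (g n) (rec_nat 0 (\<lambda>_ r. Suc (pair (f n) r)) (k n)))"
    by (intro computable_intros assms computable_comp[OF assms(1)])
  ultimately show ?thesis by (simp only: query_def)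
qed

text \<open>
  Applying an associate to a constant sequence is a relation here, because outside the domain of
  the encoded function there may be no answer.
\<close>
definition answers :: "baire \<Rightarrow> nat \<Rightarrow> nat \<Rightarrow> nat \<Rightarrow> bool" where
  "answers q n y v \<longleftrightarrow> (\<exists>l. q (query (\<lambda>_. n) y l) = Suc v \<and> (\<forall>j<l. q (query (\<lambda>_. n) y j) = 0))"

lemma answers_iff:
  assumes "associate q D F" "(\<lambda>_. n) \<in> D"
  shows "answers q n y v \<longleftrightarrow> F (\<lambda>_. n) y = v"
proof -
  obtain k where k: "q (query (\<lambda>_. n) y k) = Suc (F (\<lambda>_. n) y)" "\<forall>j<k. q (query (\<lambda>_. n) y j) = 0"
    using assms unfolding associate_def by blast
  show ?thesis
  proof
    assume "answers q n y v"
    then obtain l where l: "q (query (\<lambda>_. n) y l) = Suc v" "\<forall>j<l. q (query (\<lambda>_. n) y j) = 0"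
      unfolding answers_def by blast
    have "k = l" using k l by (metis linorder_neqE_nat nat.distinct(1))
    with k l show "F (\<lambda>_. n) y = v" by simp
  next
    assume "F (\<lambda>_. n) y = v"
    then show "answers q n y v" unfolding answers_def using k by blast
  qed
qed

lemma semidecidable_answers:
  assumes "computable q"
  shows "semidecidable {m. answers q (left m) (left (right m)) (right (right m))}"
  unfolding answers_def
  by (intro semidecidable_ex semidecidable_decidable computable_intros computable_comp[OF assms])

lemma markov_opens_iff:
  assumes U: "opens markov q = Some U" and total: "\<forall>x. phi i x \<noteq> None"
  shows "U (\<lambda>x. the (phi i x)) = STop \<longleftrightarrow>
    (\<exists>y k v. q (query (\<lambda>_. i) y k) = Suc (Suc v) \<and> (\<forall>j<k. q (query (\<lambda>_. i) y j) = 0))"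
proof -
  obtain G where G: "associate q (dom markov) G" "realizer markov rep_sierpinski G U"
    using U unfolding opens_def fun_space_eq_Some_iff by blast
  have mi: "markov (\<lambda>_. i) = Some (\<lambda>x. the (phi i x))"
    unfolding markov_eq_Some_iff using total by auto
  then have "rep_sierpinski (G (\<lambda>_. i)) = Some (U (\<lambda>x. the (phi i x)))"
    using G(2) unfolding realizer_def by blast
  then have "U (\<lambda>x. the (phi i x)) = STop \<longleftrightarrow> G (\<lambda>_. i) \<noteq> (\<lambda>_. 0)"
    unfolding rep_sierpinski_def by (auto split: if_splits)
  also have "\<dots> \<longleftrightarrow> (\<exists>y v. G (\<lambda>_. i) y = Suc v)"
    unfolding fun_eq_iff by (metis not0_implies_Suc nat.distinct(1))
  also have "\<dots> \<longleftrightarrow> (\<exists>y v. answers q i y (Suc v))"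
    using answers_iff[OF G(1)] mi by blast
  finally show ?thesis unfolding answers_def by blast
qed

text \<open>
  A semidecidable set of indices that respects equality of total functions is a computable open
  subset: the realizer outputs, at position \<open>y\<close>, whether a witness up to \<open>y\<close> has been found.
\<close>
lemma computable_open_of_index_set:
  assumes W: "semidecidable {i. W i}"
    and ext: "\<And>i j. \<forall>x. phi i x \<noteq> None \<Longrightarrow> phi i = phi j \<Longrightarrow> W i \<longleftrightarrow> W j"
  obtains U where "computable_point (opens markov) U"
    "\<And>i. \<forall>x. phi i x \<noteq> None \<Longrightarrow> U (\<lambda>x. the (phi i x)) = STop \<longleftrightarrow> W i"
proof -
  obtain R where R: "decidable {m. R (left m) (right m)}" "\<And>i. W i \<longleftrightarrow> (\<exists>w. R i w)"
    using W by (rule semidecidableE) blast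
  \<comment> \<open>The empty prefix is coded by \<open>0\<close> and gets no answer; from a nonempty prefix, coded by the
    successor of the pair of its first entry and its tail, only that entry is used.\<close>
  define q where "q x = (if right x = 0 then 0
    else Suc (if \<exists>w\<le>left x. R (left (right x - 1)) w then 1 else 0))" for x
  have "computable q"
    unfolding q_def by (intro computable_intros decidable_comp2[OF R(1)])
  define G :: "baire \<Rightarrow> baire" where
    "G p y = (if \<exists>w\<le>y. R (p 0) w then 1 else 0)" for p y
  have assoc: "associate q (dom markov) G"
    unfolding associate_def
  proof (intro ballI allI)
    fix p y assume "p \<in> dom markov"
    then obtain i where p: "p = (\<lambda>_. i)" by (auto simp: markov_eq_Some_iff)
    show "\<exists>k. q (query p y k) = Suc (G p y) \<and> (\<forall>j<k. q (query p y j) = 0)"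
      by (rule exI[of _ 1]) (simp add: p q_def G_def query_def)
  qed
  define U where "U = (\<lambda>f\<in>ran markov. if \<exists>i. (\<forall>x. phi i x = Some (f x)) \<and> W i then STop else SBot)"
  have U: "U (\<lambda>x. the (phi i x)) = STop \<longleftrightarrow> W i" if total: "\<forall>x. phi i x \<noteq> None" for i
  proof -
    have "markov (\<lambda>_. i) = Some (\<lambda>x. the (phi i x))"
      unfolding markov_eq_Some_iff using total by auto
    then have "(\<lambda>x. the (phi i x)) \<in> ran markov" unfolding ran_def by blast
    moreover have "(\<exists>j. (\<forall>x. phi j x = Some (the (phi i x))) \<and> W j) \<longleftrightarrow> W i"
    proof
      assume "\<exists>j. (\<forall>x. phi j x = Some (the (phi i x))) \<and> W j"
      then obtain j where j: "\<forall>x. phi j x = Some (the (phi i x))" "W j" by blast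
      have "phi i x = phi j x" for x using j(1) total by simp
      then have "phi i = phi j" ..
      then show "W i" using ext[OF total] j(2) by simp
    next
      assume "W i"
      then show "\<exists>j. (\<forall>x. phi j x = Some (the (phi i x))) \<and> W j"
        using total by (intro exI[of _ i]) simp
    qed
    ultimately show ?thesis unfolding U_def by simp
  qed
  have "realizer markov rep_sierpinski G U"
    unfolding realizer_def
  proof (intro allI impI)
    fix p f assume "markov p = Some f"
    then obtain i where i: "p = (\<lambda>_. i)" "\<forall>x. phi i x = Some (f x)"
      unfolding markov_eq_Some_iff by blast
    then have total: "\<forall>x. phi i x \<noteq> None" and f: "f = (\<lambda>x. the (phi i x))" by auto
    have "G p = (\<lambda>_. 0) \<longleftrightarrow> \<not> W i"
      unfolding G_def i(1) R(2) fun_eq_iff by auto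
    then have "rep_sierpinski (G p) = Some (if W i then STop else SBot)"
      unfolding rep_sierpinski_def by auto
    moreover have "U f = (if W i then STop else SBot)"
      using U[OF total] f by (metis sierpinski.exhaust)
    ultimately show "rep_sierpinski (G p) = Some (U f)" by simp
  qed
  then have "opens markov q = Some U"
    unfolding opens_def fun_space_eq_Some_iff using assoc U_def by auto
  then have "computable_point (opens markov) U"
    unfolding computable_point_def using \<open>computable q\<close> by blast
  then show thesis using U by (rule that)
qed

text \<open>
  The associate \<open>Q\<close> of \<open>h\<close>, read at the constant sequence \<open>n\<close>, gives an associate of \<open>h n\<close>; read in
  turn at the constant sequence \<open>i\<close>, this one has a nonzero value exactly if \<open>h n\<close> contains the
  \<open>i\<close>-th function.  Both readings, and the search for a nonzero value, are semidecidable.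
\<close>
lemma computable_family_of_opens:
  assumes "computable_fun (restrict_repr rep_nat S) (opens markov) h"
  obtains E where "semidecidable {m. E (left m) (right m)}"
    "\<And>n i. n \<in> S \<Longrightarrow> \<forall>x. phi i x \<noteq> None \<Longrightarrow> h n (\<lambda>x. the (phi i x)) = STop \<longleftrightarrow> E n i"
proof -
  obtain F Q where Q: "computable Q" "associate Q (dom (restrict_repr rep_nat S)) F"
    and F: "realizer (restrict_repr rep_nat S) (opens markov) F h"
    using assms unfolding computable_fun_def computable_on_def by blast
  have name: "restrict_repr rep_nat S (\<lambda>_. n) = Some n" if "n \<in> S" for n
    using that by (simp add: restrict_repr_def rep_nat_def)
  define E where "E n i \<longleftrightarrow> (\<exists>y k v. answers Q n (query (\<lambda>_. i) y k) (Suc (Suc v)) \<and>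
    (\<forall>j<k. answers Q n (query (\<lambda>_. i) y j) 0))" for n i
  have answers: "semidecidable {m. answers Q (f m) (g m) (k m)}"
    if "computable f" "computable g" "computable k" for f g k
    using semidecidable_comp[OF semidecidable_answers[OF Q(1)]
        computable_pair[OF that(1) computable_pair[OF that(2,3)]]] by simp
  have "semidecidable {m. E (left m) (right m)}"
    unfolding E_def by (intro semidecidable_intros answers computable_intros)
  moreover have "h n (\<lambda>x. the (phi i x)) = STop \<longleftrightarrow> E n i"
    if n: "n \<in> S" and total: "\<forall>x. phi i x \<noteq> None" for n i
  proof -
    have "opens markov (F (\<lambda>_. n)) = Some (h n)"
      using F name[OF n] unfolding realizer_def by blast
    moreover have "answers Q n y v \<longleftrightarrow> F (\<lambda>_. n) y = v" for y v
      using name[OF n] by (intro answers_iff[OF Q(2)]) blast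
    ultimately show ?thesis
      unfolding E_def by (simp add: markov_opens_iff[OF _ total])
  qed
  ultimately show thesis by (rule that)
qed

theorem corollary6p2:
  shows "\<not> (\<exists>S h. Sigma03 S \<and>
            computable_fun (restrict_repr rep_nat S) (opens markov) h \<and>
            h ` S = {U. computable_point (opens markov) U})"
proof
  assume "\<exists>S h. Sigma03 S \<and>
            computable_fun (restrict_repr rep_nat S) (opens markov) h \<and>
            h ` S = {U. computable_point (opens markov) U}"
  then obtain S h where S: "Sigma03 S"
    and h: "computable_fun (restrict_repr rep_nat S) (opens markov) h"
    and onto: "h ` S = {U. computable_point (opens markov) U}"
    by blast
  obtain R0 where R0: "decidable R0"
    "S = {n. \<exists>a. \<forall>b. \<exists>c. pair n (pair a (pair b c)) \<in> R0}"
    using S unfolding Sigma03_def by blast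
  \<comment> \<open>The outer existential witness \<open>a\<close> is made part of the parameter \<open>m = pair n a\<close>, which turns the
    \<open>\<Sigma>\<^sup>0\<^sub>3\<close> condition on \<open>n\<close> into a \<open>\<Pi>\<^sup>0\<^sub>2\<close> condition on \<open>m\<close>.\<close>
  define R where "R m b c \<longleftrightarrow> pair (left m) (pair (right m) (pair b c)) \<in> R0" for m b c
  have decR: "decidable {n. R (left n) (left (right n)) (right (right n))}"
    unfolding R_def
    by (rule decidable_comp[of "\<lambda>n. n \<in> R0"]) (use R0(1) in simp, intro computable_intros)
  have left_S: "left m \<in> S" if "\<forall>b. \<exists>c. R m b c" for m
    using that unfolding R_def R0(2) by blast
  obtain E where E: "semidecidable {m. E (left m) (right m)}"
    "\<And>n i. n \<in> S \<Longrightarrow> \<forall>x. phi i x \<noteq> None \<Longrightarrow> h n (\<lambda>x. the (phi i x)) = STop \<longleftrightarrow> E n i"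
    using h by (rule computable_family_of_opens) blast
  obtain T where T: "decidable {m. T (left m) (right m)}"
    "\<And>m. E (left m) (right m) \<longleftrightarrow> (\<exists>w. T m w)"
    using E(1) by (rule semidecidableE) blast
  define enum where "enum m i w \<longleftrightarrow> T (pair (left m) i) w" for m i w
  have enum: "(\<exists>w. enum m i w) \<longleftrightarrow> E (left m) i" for m i
    unfolding enum_def using T(2)[of "pair (left m) i"] by simp
  have "computable (\<lambda>n. if left n = Suc (right n) then 1 else 0)"
    by (intro computable_intros)
  with decR obtain index where index: "computable (\<lambda>n. index (left n) (right n))"
    "\<And>m e x. \<forall>b. \<exists>c. R m b c \<Longrightarrow>
      phi (index m e) x = Some (pair (head R m x) (if e = Suc x then 1 else 0))"
    by (rule index_head_body) blast
  interpret extensional_family R enum index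
  proof
    show "decidable {n. enum (left n) (left (right n)) (right (right n))}"
      unfolding enum_def by (intro decidable_comp2[OF T(1)] computable_intros)
    show "(\<exists>w. enum m i w) \<longleftrightarrow> (\<exists>w. enum m j w)"
      if "\<forall>b. \<exists>c. R m b c" "\<forall>x. phi i x \<noteq> None" "phi i = phi j" for m i j
      using E(2)[OF left_S[OF that(1)] that(2)] E(2)[OF left_S[OF that(1)], of j] that(2,3)
      unfolding enum by simp
  qed (use decR index in blast)+
  obtain U where U: "computable_point (opens markov) U"
    "\<And>i. \<forall>x. phi i x \<noteq> None \<Longrightarrow> U (\<lambda>x. the (phi i x)) = STop \<longleftrightarrow> diagonal i"
    using semidecidable_diagonal diagonal_extensional by (rule computable_open_of_index_set) blast+
  then have "U \<in> h ` S" using onto by blast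
  then obtain n where n: "n \<in> S" "U = h n" by blast
  then obtain a where "\<forall>b. \<exists>c. pair n (pair a (pair b c)) \<in> R0"
    unfolding R0(2) by blast
  then have m: "\<forall>b. \<exists>c. R (pair n a) b c" unfolding R_def by simp
  have "diagonal (index (pair n a) e) \<longleftrightarrow> listed (pair n a) (index (pair n a) e)" for e
  proof -
    have total: "\<forall>x. phi (index (pair n a) e) x \<noteq> None" by (simp add: index(2)[OF m])
    show ?thesis
      using U(2)[OF total] E(2)[OF n(1) total] n(2) unfolding listed_def enum by simp
  qed
  then show False using diagonal_not_listed[OF m] by blast
qed

end
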